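(* Let $q$ be a prime power, let $n \geq 1$ be an integer, and let $c$ be a Singer cycle in $\mathrm{GL}_n(\mathbb{F}_q)$. Let $t$ be a reflection in $\mathrm{GL}_n(\mathbb{F}_q)$, and suppose that it is not the case that both $n = 2$ and $t$ normalizes the cyclic subgroup $\langle c \rangle$. Then $\langle c, t \rangle = \mathrm{GL}_n(\mathbb{F}_q)$. In particular, if $n \geq 3$, then $\langle c, t\rangle = \mathrm{GL}_n(\mathbb{F}_q)$ for every reflection $t \in \mathrm{GL}_n(\mathbb{F}_q)$.
   Context: $\mathbb{F}_q$ denotes the finite field with $q$ elements. A reflection in $\mathrm{GL}_n(\mathbb{F}_q)$ is a non-identity element that fixes pointwise a hyperplane (a linear subspace of codimension $1$) of $\mathbb{F}_q^n$; reflections need not have order $2$ and need not be diagonalizable. A Singer cycle in $\mathrm{GL}_n(\mathbb{F}_q)$ is an element of multiplicative order $q^n - 1$; equivalently, an element that acts transitively on $\mathbb{F}_q^n \smallsetminus \{0\}$; equivalently, an element having as an eigenvalue over $\overline{\mathbb{F}_q}$ a cyclic generator of $\mathbb{F}_{q^n}^\times$. *)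

theory Defs
  imports "HOL-Analysis.Analysis" "HOL-Algebra.Algebra"
begin

text \<open>The field with \<open>q\<close> elements is a type \<open>'a :: {field, finite}\<close> with \<open>CARD('a) = q\<close>, and
  the dimension is \<open>CARD('n)\<close>, which is positive because types are nonempty.\<close>

definition GL :: "('a::field ^ 'n::finite ^ 'n) monoid" where
  "GL = \<lparr>carrier = {A. invertible A}, mult = (**), one = mat 1\<rparr>"

lemma group_GL: "group (GL :: ('a::field ^ 'n::finite ^ 'n) monoid)"
proof (rule groupI)
  fix A :: "'a ^ 'n ^ 'n" assume "A \<in> carrier GL"
  then obtain B where "A ** B = mat 1" "B ** A = mat 1"
    by (auto simp: GL_def invertible_def)
  then show "\<exists>B\<in>carrier GL. B \<otimes>\<^bsub>GL\<^esub> A = \<one>\<^bsub>GL\<^esub>"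
    by (auto simp: GL_def invertible_def)
next
  show "\<one>\<^bsub>GL\<^esub> \<in> carrier (GL :: ('a ^ 'n ^ 'n) monoid)"
    by (auto simp: GL_def invertible_def intro!: exI[of _ "mat 1"])
qed (auto simp: GL_def invertible_mult matrix_mul_assoc)

definition singer_cycle :: "'a::{field, finite} ^ 'n::finite ^ 'n \<Rightarrow> bool" where
  "singer_cycle c \<longleftrightarrow> c \<in> carrier GL \<and> group.ord GL c = CARD('a) ^ CARD('n) - 1"

definition reflection :: "'a::field ^ 'n::finite ^ 'n \<Rightarrow> bool" where
  "reflection t \<longleftrightarrow> t \<in> carrier GL \<and> t \<noteq> mat 1 \<and>
     (\<exists>H. vec.subspace H \<and> vec.dim H = CARD('n) - 1 \<and> (\<forall>v\<in>H. t *v v = v))"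

end

theory Submission
  imports Defs "HOL-Algebra.Algebraic_Closure_Type"
begin

text \<open>Let \<open>q\<close> be the size of the field and \<open>n\<close> the dimension. A Singer cycle \<open>c\<close> permutes the nonzero
vectors transitively, so the space can be identified with the field \<open>K\<close> of \<open>q ^ n\<close> elements in such a
way that \<open>c\<close> becomes multiplication by a generator of the multiplicative group of \<open>K\<close>
(\<open>powers_act_transitively\<close>, \<open>singer_cycle_field_model\<close>). A group \<open>G\<close> containing \<open>c\<close> then contains the
multiplications by all nonzero elements of \<open>K\<close>. Every linear functional has the form
\<open>x \<mapsto> Tr (b * x)\<close>, hence, up to conjugation by a multiplication, a reflection is
\<open>x \<mapsto> x + a * Tr x\<close> with \<open>a \<noteq> 0\<close>.

The point is that \<open>G\<close> must contain all transvections \<open>x \<mapsto> x + d * Tr x\<close> with \<open>Tr d = 0\<close>; the set of those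
\<open>d\<close> that occur is an additive group \<open>D0\<close>. For each \<open>l \<noteq> 0\<close>, conjugating the reflection by its own
conjugate under multiplication by \<open>l\<close>, and moving the axis back by another multiplication, gives a second
reflection with the same axis and the same determinant. The quotient of the two is a transvection, and
this produces an element of \<open>D0\<close> that is, up to the constant \<open>(1 + Tr a)\<^sup>2\<close>, a linear combination of
the characters \<open>l ^ (q ^ i) / l ^ (q ^ j)\<close> of the multiplicative group. As \<open>D0\<close> is only known to be additive,
the characters have to be separated with weights in the prime field: the weights are absolute traces
\<open>abs_tr (k * l / l ^ (q ^ s))\<close>, and uniqueness of base \<open>p\<close> digits shows that they pick out exactly the
coefficients with \<open>i - j \<equiv> s\<close> modulo \<open>n\<close> (\<open>trace_character_sum\<close>). The outcome is that
\<open>(1 + Tr a) * k ^ (q ^ s) - k - a * Tr k\<close> lies in \<open>(1 + Tr a)\<^sup>2 D0\<close> for every \<open>k\<close> and every \<open>0 < s < n\<close>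
(\<open>twisted_difference_in_D0\<close>).

For \<open>n \<ge> 3\<close>, two values of \<open>s\<close> may be subtracted, and the differences \<open>k - k ^ q\<close> exhaust the elements of trace
zero by the additive form of Hilbert's Theorem 90. For \<open>n = 2\<close> the same works with \<open>k\<close> and \<open>k ^ q\<close> unless
\<open>Tr a = - 2\<close>; in that case the element above is \<open>- (1 + a) * Tr k\<close>, which still
gives everything unless \<open>a = - 1\<close>. But then the reflection is \<open>x \<mapsto> - (x ^ q)\<close>, which normalizes the
multiplications, and this is the excluded case (\<open>trace_zero_in_D0\<close>).

Finally, elementary row operations reduce any invertible matrix to a dilation with the same determinant, and the determinant of
\<open>c\<close> is the norm of a generator of \<open>K\<close>, hence generates the multiplicative group of the base field. So the
transvections together with \<open>c\<close> generate the full linear group (\<open>shears_and_determinants_generate\<close>,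
\<open>det_power_surj\<close>). For \<open>n = 1\<close> the last step alone suffices.\<close>

hide_const (open) Divisibility.prime Polynomials.degree up_ring.coeff up_ring.monom

section \<open>Frobenius powers and traces of a finite field\<close>

lemma sum_two_powers_sorted:
  fixes p :: nat
  assumes "p \<ge> 2" "a \<le> b" "c \<le> d" "p ^ a + p ^ b = p ^ c + p ^ d"
  shows "a = c \<and> b = d"
proof -
  have top: "d \<le> b" if "a \<le> b" "p ^ a + p ^ b = p ^ c + p ^ d" for a b c d
  proof (rule ccontr)
    assume "\<not> d \<le> b"
    have "p ^ a \<le> p ^ b" using that \<open>p \<ge> 2\<close> by (intro power_increasing) auto
    moreover have "2 * p ^ b \<le> p ^ Suc b" using \<open>p \<ge> 2\<close> by simp
    moreover have "p ^ Suc b \<le> p ^ d"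
      using \<open>\<not> d \<le> b\<close> \<open>p \<ge> 2\<close> by (intro power_increasing) auto
    moreover have "p ^ c > 0" using \<open>p \<ge> 2\<close> by simp
    ultimately show False using that(2) by linarith
  qed
  have "b = d" using top[of a b c d] top[of c d a b] assms by simp
  thus ?thesis using assms by simp
qed

text \<open>A sum of two powers of \<open>p\<close> determines the exponents, also for \<open>p = 2\<close>, where \<open>p ^ a + p ^ a = p ^ (a + 1)\<close>
is again a power but not a sum of two powers of other exponents. This is what separates characters of the form
\<open>x ^ (p ^ a) / x ^ (p ^ c)\<close> with \<open>a \<noteq> c\<close>.\<close>

lemma sum_two_powers_eq_iff:
  fixes p :: nat
  assumes "p \<ge> 2" and "a \<noteq> c"
  shows "p ^ a + p ^ b = p ^ c + p ^ d \<longleftrightarrow> a = d \<and> b = c"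
proof
  assume eq: "p ^ a + p ^ b = p ^ c + p ^ d"
  have "(min a b = min c d) \<and> (max a b = max c d)"
    by (rule sum_two_powers_sorted[OF \<open>p \<ge> 2\<close>])
       (use eq in \<open>auto simp: min_def max_def add.commute\<close>)
  thus "a = d \<and> b = c" using \<open>a \<noteq> c\<close> by (auto simp: min_def max_def split: if_splits)
qed auto

text \<open>Traces are sums over a cyclic orbit of Frobenius, so applying Frobenius once more only rotates the summands.\<close>

lemma sum_shift_cyclic:
  fixes f :: "nat \<Rightarrow> 'b::ab_group_add"
  assumes "f m = f 0"
  shows "(\<Sum>i<m. f (Suc i)) = (\<Sum>i<m. f i)"
proof -
  have "f 0 + (\<Sum>i<m. f (Suc i)) = f 0 + (\<Sum>i<m. f i)"
    using sum.lessThan_Suc_shift[of f m] sum.lessThan_Suc[of f m] assms by (simp add: add.commute)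
  thus ?thesis by simp
qed

lemma power_commute_exponents: "((x::'b::monoid_mult) ^ a) ^ b = (x ^ b) ^ a"
  by (simp add: mult.commute flip: power_mult)

text \<open>The field with \<open>p ^ (r * n)\<close> elements is treated as a subset \<open>K\<close> of an ambient field of characteristic \<open>p\<close>, and the
assumption on \<open>w\<close> says that it is a generator of the multiplicative group of \<open>K\<close>. The base field
is the fixed field of \<open>frob r\<close>; \<open>Tr\<close> is the trace down to it and \<open>abs_tr\<close> the trace
down to the prime field.\<close>

locale finite_field_extension =
  fixes p r n :: nat and w :: "'l::field"
  assumes p: "prime p" "semiring_char TYPE('l) = p" and r: "r > 0" and n: "n > 0"
    and w: "\<And>j. w ^ j = 1 \<longleftrightarrow> p ^ (r * n) - 1 dvd j"
begin

definition frob :: "nat \<Rightarrow> 'l \<Rightarrow> 'l" where "frob k x = x ^ (p ^ k)"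

definition K :: "'l set" where "K = {x. frob (r * n) x = x}"

definition Tr :: "'l \<Rightarrow> 'l" where "Tr x = (\<Sum>i<n. frob (r * i) x)"

definition abs_tr :: "'l \<Rightarrow> 'l" where "abs_tr x = (\<Sum>k<r * n. frob k x)"

lemma p_ge_2: "p \<ge> 2"
  using p(1) by (rule prime_ge_2_nat)

lemma rn: "r * n > 0" using r n by simp

lemma pM: "p ^ (r * n) \<ge> 2"
proof -
  have "p ^ (r * n) \<ge> p ^ 1" using rn p_ge_2 by (intro power_increasing) auto
  thus ?thesis using p_ge_2 by simp
qed

lemma frob_simps [simp]:
  "frob k 0 = 0" "frob k 1 = 1" "frob 0 x = x"
  "frob k (x + y) = frob k x + frob k y"
  "frob k (x * y) = frob k x * frob k y"
  "frob k (x / y) = frob k x / frob k y"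
  "frob k (inverse x) = inverse (frob k x)"
  "frob k (x ^ m) = frob k x ^ m"
  "frob i (frob k x) = frob (i + k) x"
  "frob k x = 0 \<longleftrightarrow> x = 0"
proof -
  show "frob k 0 = 0" using p_ge_2 by (simp add: frob_def)
  show "frob k (x + y) = frob k x + frob k y"
    unfolding frob_def by (rule freshmans_dream') (use p in auto)
  show "frob i (frob k x) = frob (i + k) x"
    by (simp add: frob_def power_add mult.commute[of "p ^ i"] power_mult)
  show "frob k (x ^ m) = frob k x ^ m"
    by (simp add: frob_def power_commuting_commutes flip: power_mult)
  show "frob k x = 0 \<longleftrightarrow> x = 0" using p_ge_2 by (simp add: frob_def)
qed (simp_all add: frob_def power_mult_distrib power_divide power_inverse)

lemma frob_sum [simp]: "frob k (sum f A) = (\<Sum>x\<in>A. frob k (f x))"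
  using p by (simp add: frob_def freshmans_dream_sum'[of "p^k" k])

lemma frob_minus [simp]: "frob k (- x) = - frob k x"
proof -
  have "frob k x + frob k (- x) = frob k (x + - x)" by (rule frob_simps(4)[symmetric])
  also have "\<dots> = 0" by simp
  finally show ?thesis by (rule minus_unique[symmetric])
qed

lemma frob_diff [simp]: "frob k (x - y) = frob k x - frob k y"
proof -
  have "frob k (x - y) = frob k (x + - y)" by simp
  also have "\<dots> = frob k x - frob k y" by (simp only: frob_simps(4) frob_minus) simp
  finally show ?thesis .
qed

lemma K_frob [simp]: "x \<in> K \<Longrightarrow> frob (r * n) x = x"
  by (simp add: K_def)

lemma K_frob_add [simp]: "x \<in> K \<Longrightarrow> frob (i + r * n) x = frob i x"
proof -
  assume "x \<in> K"
  hence "frob i (frob (r * n) x) = frob i x" by (simp only: K_frob)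
  thus ?thesis by simp
qed

lemma K_I: "frob (r * n) x = x \<Longrightarrow> x \<in> K"
  by (simp only: K_def mem_Collect_eq)

lemma K_frob_mod: "x \<in> K \<Longrightarrow> frob (i mod (r * n)) x = frob i x"
proof -
  assume x: "x \<in> K"
  have "frob (j + r * n * m) x = frob j x" for j m
  proof (induction m)
    case (Suc m)
    have "frob (j + r * n * Suc m) x = frob ((j + r * n * m) + r * n) x"
      by (simp add: algebra_simps)
    thus ?case using Suc x by (simp only: K_frob_add)
  qed auto
  from this[of "i mod (r * n)" "i div (r * n)"] show ?thesis by simp
qed

lemma K_closed [simp, intro]:
  "0 \<in> K" "1 \<in> K"
  "x \<in> K \<Longrightarrow> y \<in> K \<Longrightarrow> x + y \<in> K"
  "x \<in> K \<Longrightarrow> y \<in> K \<Longrightarrow> x - y \<in> K"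
  "x \<in> K \<Longrightarrow> y \<in> K \<Longrightarrow> x * y \<in> K"
  "x \<in> K \<Longrightarrow> y \<in> K \<Longrightarrow> x / y \<in> K"
  "x \<in> K \<Longrightarrow> - x \<in> K"
  "x \<in> K \<Longrightarrow> inverse x \<in> K"
  "x \<in> K \<Longrightarrow> x ^ k \<in> K"
  by (auto intro!: K_I)

lemma K_closed_frob [simp, intro]: "x \<in> K \<Longrightarrow> frob k x \<in> K"
proof -
  assume "x \<in> K"
  hence "frob (r * n) (frob k x) = frob k x" by (simp add: add.commute[of "r * n"])
  thus ?thesis by (rule K_I)
qed

lemma K_closed_sum [intro]: "(\<And>x. x \<in> A \<Longrightarrow> f x \<in> K) \<Longrightarrow> sum f A \<in> K"
  by (induction A rule: infinite_finite_induct) auto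

lemma Tr_in_K [simp, intro]: "x \<in> K \<Longrightarrow> Tr x \<in> K"
  by (auto simp: Tr_def)

lemma Tr_add [simp]: "Tr (x + y) = Tr x + Tr y"
  and Tr_diff [simp]: "Tr (x - y) = Tr x - Tr y"
  and Tr_minus [simp]: "Tr (- x) = - Tr x"
  and Tr_0 [simp]: "Tr 0 = 0"
  by (auto simp: Tr_def sum.distrib sum_subtractf sum_negf)

lemma frob_Tr: "x \<in> K \<Longrightarrow> frob r (Tr x) = Tr x"
  using sum_shift_cyclic[of "\<lambda>i. frob (r * i) x" n] by (simp add: Tr_def)

lemma frob_abs_tr: "x \<in> K \<Longrightarrow> frob 1 (abs_tr x) = abs_tr x"
  using sum_shift_cyclic[of "\<lambda>i. frob i x" "r * n"] by (simp add: abs_tr_def)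

lemma frob_fixed:
  assumes "frob r s = s"
  shows "frob (r * i) s = s"
proof (induction i)
  case (Suc i)
  have "frob (r * Suc i) s = frob (r * i) (frob r s)" by (simp add: add.commute)
  thus ?case using assms Suc by (simp only:)
qed auto

lemma Tr_smult: "frob r s = s \<Longrightarrow> Tr (s * x) = s * Tr x"
  by (simp add: Tr_def frob_fixed sum_distrib_left)

lemma fixed_in_K: "frob r s = s \<Longrightarrow> s \<in> K"
  by (rule K_I) (rule frob_fixed)

lemma w_nonzero: "w \<noteq> 0"
proof
  assume "w = 0"
  thus False using w[of "p ^ (r * n) - 1"] pM by (simp add: power_0_left split: if_splits)
qed

lemma w_in_K: "w ^ k \<in> K"
proof -
  have "w ^ Suc (p ^ (r * n) - 1) = w" using w[of "p ^ (r * n) - 1"] by (simp only: power_Suc) simp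
  moreover have "Suc (p ^ (r * n) - 1) = p ^ (r * n)" using pM by simp
  ultimately have "w ^ (p ^ (r * n)) = w" by (simp only:)
  thus ?thesis by (intro K_closed(9) K_I) (simp add: frob_def)
qed

lemma w_inj: "inj_on (\<lambda>k. w ^ k) {..<p ^ (r * n) - 1}"
proof (rule inj_onI)
  have *: "i = j" if "i \<le> j" "j < p ^ (r * n) - 1" "w ^ i = w ^ j" for i j
  proof -
    have "w ^ (j - i) = 1" using that w_nonzero by (simp add: power_diff)
    hence "p ^ (r * n) - 1 dvd j - i" using w by simp
    thus ?thesis using that by (auto dest: dvd_imp_le)
  qed
  show "i = j" if "i \<in> {..<p ^ (r * n) - 1}" "j \<in> {..<p ^ (r * n) - 1}" "w ^ i = w ^ j" for i j
    using * that by (metis lessThan_iff linear)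
qed

text \<open>The powers of \<open>w\<close> are already as many roots of \<open>x ^ (p ^ (r * n) - 1) = 1\<close> as a field can have.\<close>

lemma K_nonzero: "K - {0} = (\<lambda>k. w ^ k) ` {..<p ^ (r * n) - 1}"
proof -
  define P :: "'l poly" where "P = monom 1 (p ^ (r * n) - 1) - 1"
  have P: "poly P x = x ^ (p ^ (r * n) - 1) - 1" for x
    by (simp add: P_def poly_monom)
  have "poly P 0 \<noteq> 0" using pM by (simp add: P power_0_left)
  hence "P \<noteq> 0" by auto
  have sub: "(\<lambda>k. w ^ k) ` {..<p ^ (r * n) - 1} \<subseteq> K - {0}"
    using w_in_K w_nonzero by auto
  have K: "K - {0} \<subseteq> {x. poly P x = 0}"
  proof safe
    fix x assume x: "x \<in> K" "x \<noteq> 0"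
    have "x * x ^ (p ^ (r * n) - 1) = x ^ (p ^ (r * n))"
      using pM by (metis Suc_diff_1 power_Suc less_le_trans pos2)
    hence "x * x ^ (p ^ (r * n) - 1) = x" using K_frob[OF x(1)] by (simp add: frob_def)
    thus "poly P x = 0" using x by (simp add: P)
  qed
  have "card {x. poly P x = 0} \<le> p ^ (r * n) - 1"
    using card_poly_roots_bound[OF \<open>P \<noteq> 0\<close>]
    by (rule order_trans) (auto simp: P_def intro!: degree_diff_le degree_monom_le)
  hence "card (K - {0}) \<le> p ^ (r * n) - 1"
    using card_mono[OF poly_roots_finite[OF \<open>P \<noteq> 0\<close>] K] by linarith
  moreover have "finite (K - {0})" using finite_subset[OF K poly_roots_finite[OF \<open>P \<noteq> 0\<close>]] .
  ultimately show ?thesis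
    using sub card_image[OF w_inj] by (intro card_seteq[symmetric]) auto
qed

lemma finite_K: "finite K"
proof -
  have "finite (K - {0})" unfolding K_nonzero by simp
  thus ?thesis by simp
qed

lemma card_K: "card K = p ^ (r * n)"
proof -
  have "card (K - {0}) = p ^ (r * n) - 1"
    unfolding K_nonzero using card_image[OF w_inj] by simp
  thus ?thesis using pM finite_K by (subst (asm) card_Diff_singleton) auto
qed

text \<open>Orthogonality of characters: the sum is geometric in the ratio \<open>w ^ A / w ^ B\<close>. The bounds on \<open>A\<close> and \<open>B\<close>
guarantee that different exponents stay different modulo the order of \<open>w\<close>.\<close>

lemma sum_unit_powers:
  fixes A B :: nat
  assumes "A < B + (p ^ (r * n) - 1)" "B < A + (p ^ (r * n) - 1)"
  shows "(\<Sum>x\<in>K-{0}. x ^ A / x ^ B) = (if A = B then - 1 else 0)"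
proof -
  have "(\<Sum>x\<in>K-{0}. x ^ A / x ^ B) = (\<Sum>k<p ^ (r * n) - 1. (w ^ A / w ^ B) ^ k)"
    unfolding K_nonzero
    by (subst sum.reindex[OF w_inj])
       (auto simp: power_divide mult.commute simp flip: power_mult)
  also have "\<dots> = (if A = B then - 1 else 0)"
  proof (cases "A = B")
    case True
    have "of_nat (p ^ (r * n)) = (0::'l)" using p rn by (auto simp: of_nat_eq_0_iff_char_dvd)
    hence "of_nat (p ^ (r * n) - 1) = (-1::'l)" using pM by (subst of_nat_diff) auto
    thus ?thesis using True w_nonzero by simp
  next
    case False
    define z where "z = w ^ A / w ^ B"
    have "z \<noteq> 1"
    proof
      assume "z = 1"
      hence "w ^ A = w ^ B" using w_nonzero by (simp add: z_def)
      hence "w ^ (A - B) = 1 \<and> w ^ (B - A) = 1"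
        using w_nonzero by (cases "A \<le> B") (auto simp: power_diff)
      hence "p ^ (r * n) - 1 dvd A - B" "p ^ (r * n) - 1 dvd B - A" using w by auto
      thus False using assms False by (auto dest!: dvd_imp_le split: if_splits)
    qed
    moreover have "z ^ (p ^ (r * n) - 1) = 1"
    proof -
      have "w ^ (p ^ (r * n) - 1) = 1" using w by simp
      moreover have "(w ^ m) ^ (p ^ (r * n) - 1) = (w ^ (p ^ (r * n) - 1)) ^ m" for m
        by (rule power_commute_exponents)
      ultimately show ?thesis by (simp add: z_def power_divide)
    qed
    ultimately show ?thesis using False
      by (simp add: geometric_sum flip: z_def)
  qed
  finally show ?thesis .
qed

text \<open>The absolute trace is a root of \<open>x ^ p = x\<close>, and the images of \<open>0, \<dots>, p - 1\<close> are all the roots. Hence multiplying by an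
absolute trace amounts to repeated addition, which is possible in any additive group.\<close>

lemma abs_tr_is_of_nat:
  assumes "x \<in> K"
  shows "\<exists>m. abs_tr x = of_nat m"
proof -
  define P :: "'l poly" where "P = monom 1 p - monom 1 1"
  have P: "poly P x = x ^ p - x" for x by (simp add: P_def poly_monom)
  have "coeff P p = 1" using p_ge_2 by (simp add: P_def)
  hence "P \<noteq> 0" by auto
  have fermat: "of_nat m ^ p = (of_nat m :: 'l)" for m
  proof -
    have "(\<Sum>x<m. 1 :: 'l) ^ p = (\<Sum>x<m. 1 ^ p)"
      by (rule freshmans_dream_sum) (simp_all add: p)
    thus ?thesis by simp
  qed
  have sub: "of_nat ` {..<p} \<subseteq> {x::'l. poly P x = 0}"
    using fermat by (auto simp: P)
  have "inj_on (of_nat :: nat \<Rightarrow> 'l) {..<p}"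
  proof (rule inj_onI)
    have *: "i = j" if "i \<le> j" "j < p" "of_nat i = (of_nat j :: 'l)" for i j
    proof -
      have "of_nat (j - i) = (0 :: 'l)" using that by (simp add: of_nat_diff)
      hence "p dvd j - i" using p by (simp add: of_nat_eq_0_iff_char_dvd)
      thus ?thesis using that by (auto dest: dvd_imp_le)
    qed
    show "i = j" if "i \<in> {..<p}" "j \<in> {..<p}" "of_nat i = (of_nat j :: 'l)" for i j
      using * that by (metis lessThan_iff linear)
  qed
  hence "card ((of_nat :: nat \<Rightarrow> 'l) ` {..<p}) = p" by (simp add: card_image)
  moreover have "card {x. poly P x = 0} \<le> p"
    using card_poly_roots_bound[OF \<open>P \<noteq> 0\<close>]
    by (rule order_trans) (use p_ge_2 in \<open>auto simp: P_def intro!: degree_diff_le order_trans[OF degree_monom_le]\<close>)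
  ultimately have "of_nat ` {..<p} = {x::'l. poly P x = 0}"
    using sub by (intro card_seteq) (auto intro!: poly_roots_finite \<open>P \<noteq> 0\<close>)
  moreover have "poly P (abs_tr x) = 0"
    using frob_abs_tr[OF assms] by (simp add: P frob_def)
  ultimately show ?thesis by blast
qed

text \<open>The absolute trace expands into the characters \<open>x ^ (p ^ l) / x ^ (p ^ (l + r * s))\<close>. By orthogonality and
uniqueness of digits, only the summand inverse to \<open>x ^ (q ^ i) / x ^ (q ^ j)\<close>, with \<open>q = p ^ r\<close>, contributes;
this forces \<open>l = r * j\<close>.\<close>

lemma trace_character_sum:
  assumes k: "k \<in> K" and s: "s > 0" "s < n" and ij: "i < n" "j < n"
  shows "(\<Sum>x\<in>K-{0}. abs_tr (k * x / frob (r * s) x) * (frob (r * i) x / frob (r * j) x))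
       = (if i = (s + j) mod n then - frob (r * j) k else 0)"
proof -
  have "(\<Sum>x\<in>K-{0}. abs_tr (k * x / frob (r * s) x) * (frob (r * i) x / frob (r * j) x))
      = (\<Sum>x\<in>K-{0}. \<Sum>l<r * n. frob l k *
           (frob l x / frob (l + r * s) x * (frob (r * i) x / frob (r * j) x)))"
    by (simp add: abs_tr_def sum_distrib_right sum_distrib_left mult_ac)
  also have "\<dots> = (\<Sum>l<r * n. frob l k * (\<Sum>x\<in>K-{0}.
           (frob l x / frob (l + r * s) x * (frob (r * i) x / frob (r * j) x))))"
    by (subst sum.swap) (simp add: sum_distrib_left)
  also have "\<dots> = (\<Sum>l<r * n. if l = r * j then (if i = (s + j) mod n then - frob l k else 0) else 0)"
  proof (rule sum.cong[OF refl])
    fix l assume l: "l \<in> {..<r * n}"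
    define b where "b = (l + r * s) mod (r * n)"
    have lt: "b < r * n" "r * i < r * n" "r * j < r * n" "l < r * n"
      using rn ij l by (auto simp: b_def)
    have "b \<noteq> l"
    proof
      assume "b = l"
      hence "(l + r * s) mod (r * n) = (l + 0) mod (r * n)" using l by (simp add: b_def)
      hence "(r * s) mod (r * n) = 0 mod (r * n)" by (metis mod_add_cong mod_add_left_eq
        add.commute add_diff_cancel_left' le_add1 mod_eq_dvd_iff_nat mod_0 mod_0_imp_dvd dvd_imp_mod_0)
      thus False using s r by (simp add: mod_mult_mult1)
    qed
    have bnd: "p ^ x \<le> p ^ (r * n - 1)" "p ^ x \<ge> 1" if "x < r * n" for x
      using that p_ge_2 by (auto intro: power_increasing)
    \<comment> \<open>Both exponents lie between \<open>2\<close> and \<open>2 * p ^ (r * n - 1) \<le> p ^ (r * n)\<close>, so their difference is smaller than the order of \<open>w\<close>.\<close>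
    have big: "2 * p ^ (r * n - 1) \<le> p ^ (r * n)"
    proof -
      have "p ^ (r * n) = p * p ^ (r * n - 1)" using rn by (metis Suc_diff_1 power_Suc)
      thus ?thesis using p_ge_2 by simp
    qed
    have "(\<Sum>x\<in>K-{0}. frob l x / frob (l + r * s) x * (frob (r * i) x / frob (r * j) x))
        = (\<Sum>x\<in>K-{0}. x ^ (p ^ l + p ^ (r * i)) / x ^ (p ^ b + p ^ (r * j)))"
    proof (rule sum.cong[OF refl])
      fix x assume "x \<in> K - {0}"
      hence "frob (l + r * s) x = frob b x" unfolding b_def by (subst K_frob_mod) auto
      thus "frob l x / frob (l + r * s) x * (frob (r * i) x / frob (r * j) x)
          = x ^ (p ^ l + p ^ (r * i)) / x ^ (p ^ b + p ^ (r * j))"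
        by (simp add: frob_def power_add)
    qed
    also have "\<dots> = (if p ^ l + p ^ (r * i) = p ^ b + p ^ (r * j) then - 1 else 0)"
      using bnd[OF lt(1)] bnd[OF lt(2)] bnd[OF lt(3)] bnd[OF lt(4)] big
      by (intro sum_unit_powers) linarith+
    also have "p ^ l + p ^ (r * i) = p ^ b + p ^ (r * j) \<longleftrightarrow> l = r * j \<and> r * i = b"
      using \<open>b \<noteq> l\<close> p_ge_2 by (intro sum_two_powers_eq_iff) auto
    also have "\<dots> \<longleftrightarrow> l = r * j \<and> i = (s + j) mod n"
    proof -
      have "b = r * ((s + j) mod n)" if "l = r * j"
        using that by (simp add: b_def mult_mod_right algebra_simps)
      thus ?thesis using r by auto
    qed
    finally show "frob l k * (\<Sum>x\<in>K-{0}. frob l x / frob (l + r * s) x * (frob (r * i) x / frob (r * j) x))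
        = (if l = r * j then (if i = (s + j) mod n then - frob l k else 0) else 0)"
      by auto
  qed
  also have "\<dots> = (if i = (s + j) mod n then - frob (r * j) k else 0)"
    using ij r by (subst sum.delta) auto
  finally show ?thesis .
qed

text \<open>The trace is a nonzero polynomial of degree less than the number of elements of \<open>K\<close>.\<close>

lemma Tr_nonzero_exists: "\<exists>x\<in>K. Tr x \<noteq> 0"
proof (rule ccontr)
  assume "\<not> ?thesis"
  hence *: "K \<subseteq> {x. Tr x = 0}" by auto
  define P :: "'l poly" where "P = (\<Sum>i<n. monom 1 (p ^ (r * i)))"
  have P: "poly P x = Tr x" for x by (simp add: P_def Tr_def poly_sum poly_monom frob_def)
  have "coeff P 1 = (\<Sum>i<n. if i = 0 then 1 else 0)"
    unfolding P_def using r p_ge_2 by (auto simp: coeff_sum intro!: sum.cong)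
  also have "\<dots> = 1" using n by simp
  finally have "P \<noteq> 0" by auto
  have "degree P \<le> p ^ (r * n - 1)" unfolding P_def
  proof (rule degree_sum_le)
    fix i assume "i \<in> {..<n}"
    hence "r * i < r * n" using r by simp
    hence "r * i \<le> r * n - 1" by linarith
    hence "p ^ (r * i) \<le> p ^ (r * n - 1)" using p_ge_2 by (intro power_increasing) auto
    thus "degree (monom (1::'l) (p ^ (r * i))) \<le> p ^ (r * n - 1)"
      by (rule order_trans[OF degree_monom_le])
  qed auto
  hence "card K \<le> p ^ (r * n - 1)"
    using card_mono[OF poly_roots_finite[OF \<open>P \<noteq> 0\<close>], of K] card_poly_roots_bound[OF \<open>P \<noteq> 0\<close>] *
    by (auto simp: P)
  moreover have "p ^ (r * n - 1) < p ^ (r * n)"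
    using rn p_ge_2 by (intro power_strict_increasing) auto
  ultimately show False using card_K by linarith
qed

lemma Tr_surj:
  assumes "frob r s = s"
  shows "\<exists>x\<in>K. Tr x = s"
proof -
  obtain y where y: "y \<in> K" "Tr y \<noteq> 0" using Tr_nonzero_exists by blast
  have "frob r (s / Tr y) = s / Tr y" using assms frob_Tr[OF y(1)] by simp
  hence "Tr (s / Tr y * y) = s" using y by (subst Tr_smult) auto
  moreover have "s / Tr y * y \<in> K" using y fixed_in_K[OF assms] by auto
  ultimately show ?thesis by blast
qed

text \<open>The additive form of Hilbert's Theorem 90, by the usual explicit formula: if \<open>y\<close> has trace one and \<open>S i\<close> is
the sum of the first \<open>i\<close> conjugates of \<open>x\<close>, then \<open>\<Sum>i. S i * frob (r * i) y\<close> is a solution, because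
\<open>frob r (S i) = S (i + 1) - x\<close>.\<close>

lemma trace_zero_is_coboundary:
  assumes x: "x \<in> K" "Tr x = 0"
  shows "\<exists>k\<in>K. x = k - frob r k"
proof -
  obtain y where y: "y \<in> K" "Tr y = 1" using Tr_surj[of 1] by auto
  define S where "S i = (\<Sum>j<i. frob (r * j) x)" for i
  have S: "frob r (S i) = S (Suc i) - x" for i
    using sum.lessThan_Suc_shift[of "\<lambda>j. frob (r * j) x" i] by (simp add: S_def)
  define k where "k = (\<Sum>i<n. S i * frob (r * i) y)"
  have "frob r k = (\<Sum>i<n. S (Suc i) * frob (r * Suc i) y) - x * (\<Sum>i<n. frob (r * Suc i) y)"
    by (simp add: k_def S algebra_simps sum_subtractf sum_distrib_left)
  also have "(\<Sum>i<n. frob (r * Suc i) y) = 1"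
    using y sum_shift_cyclic[of "\<lambda>i. frob (r * i) y" n] by (simp add: Tr_def)
  also have "(\<Sum>i<n. S (Suc i) * frob (r * Suc i) y) = k"
    unfolding k_def using x by (intro sum_shift_cyclic) (simp add: S_def Tr_def)
  finally have "x = k - frob r k" by simp
  moreover have "k \<in> K" using x y by (auto simp: k_def S_def)
  ultimately show ?thesis by blast
qed

end

section \<open>Transvections generated by the multiplications and one reflection\<close>

text \<open>\<open>F\<close> stands for the maps on \<open>K\<close> induced by a group of linear maps that contains all multiplications. The maps are
total functions on the ambient field of which only the values on \<open>K\<close> matter; this explains the closure
condition \<open>cong\<close>, and why a left inverse on \<open>K\<close> is accepted as the inverse map.\<close>

locale linear_action = finite_field_extension p r n w
  for p r n :: nat and w :: "'l::field" +
  fixes F :: "('l \<Rightarrow> 'l) set"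
  assumes comp: "\<And>f g. f \<in> F \<Longrightarrow> g \<in> F \<Longrightarrow> (\<lambda>x. f (g x)) \<in> F"
    and scale: "\<And>a. a \<in> K \<Longrightarrow> a \<noteq> 0 \<Longrightarrow> (\<lambda>x. a * x) \<in> F"
    and inv: "\<And>f g. f \<in> F \<Longrightarrow> (\<And>x. x \<in> K \<Longrightarrow> g (f x) = x) \<Longrightarrow> g \<in> F"
    and cong: "\<And>f g. f \<in> F \<Longrightarrow> (\<And>x. x \<in> K \<Longrightarrow> f x = g x) \<Longrightarrow> g \<in> F"
    and inj: "\<And>f. f \<in> F \<Longrightarrow> inj_on f K"
begin

text \<open>The reflections in \<open>F\<close> (and the identity, for \<open>a = 0\<close>) whose axis is the kernel of the trace. Their determinant is \<open>1 + Tr a\<close>.\<close>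

definition D :: "'l set" where
  "D = {a \<in> K. (\<lambda>x. x + a * Tr x) \<in> F}"

lemma D_K: "a \<in> D \<Longrightarrow> a \<in> K" by (simp add: D_def)

lemma D_F: "a \<in> D \<Longrightarrow> (\<lambda>x. x + a * Tr x) \<in> F" by (simp add: D_def)

lemma Tr_mult_Tr: "x \<in> K \<Longrightarrow> Tr (a * Tr x) = Tr a * Tr x"
  using Tr_smult[of "Tr x" a] by (simp add: frob_Tr mult.commute)

lemma D_det_nonzero:
  assumes "a \<in> D"
  shows "1 + Tr a \<noteq> 0"
proof
  assume *: "1 + Tr a = 0"
  have "a + a * Tr a = a * (1 + Tr a)" by (simp add: algebra_simps)
  hence "a + a * Tr a = 0 + a * Tr 0" using * by simp
  hence "a = 0"
    using inj_onD[OF inj[OF D_F[OF assms]], of a 0] D_K[OF assms] by simp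
  thus False using * by simp
qed

lemma frob_det: "a \<in> K \<Longrightarrow> frob r (1 + Tr a) = 1 + Tr a"
  by (simp add: frob_Tr)

lemma Tr_divide_fixed: "frob r s = s \<Longrightarrow> Tr (x / s) = Tr x / s"
  using Tr_smult[of "inverse s" x] by (simp add: field_simps)

lemma D_mult:
  assumes "a \<in> D" "b \<in> D"
  shows "a + b + a * Tr b \<in> D"
proof -
  have "(\<lambda>x. (x + b * Tr x) + a * Tr (x + b * Tr x)) \<in> F"
    using comp[OF D_F[OF assms(1)] D_F[OF assms(2)]] .
  hence "(\<lambda>x. x + (a + b + a * Tr b) * Tr x) \<in> F"
    by (rule cong) (simp add: Tr_mult_Tr algebra_simps)
  thus ?thesis using assms by (auto simp: D_def)
qed

lemma D_inverse:
  assumes "a \<in> D"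
  shows "- a / (1 + Tr a) \<in> D"
proof -
  define s where "s = 1 + Tr a"
  have s: "s \<noteq> 0" "frob r s = s" "Tr a = s - 1" "s \<in> K" and a: "a \<in> K"
    using D_det_nonzero[OF assms] frob_det[of a] D_K[OF assms] by (auto simp: s_def)
  have "(\<lambda>x. x + (- a / s) * Tr x) \<in> F"
  proof (rule inv[OF D_F[OF assms]])
    fix x assume x: "x \<in> K"
    have "Tr (x + a * Tr x) = Tr x + (s - 1) * Tr x"
      using x s(3) by (simp add: Tr_mult_Tr)
    hence "Tr (x + a * Tr x) = s * Tr x" by (simp add: algebra_simps)
    thus "x + a * Tr x + (- a / s) * Tr (x + a * Tr x) = x"
      using s by simp
  qed
  moreover have "- a / s \<in> K" using a s(4) by blast
  ultimately show ?thesis by (simp add: D_def s_def)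
qed

definition D0 :: "'l set" where "D0 = {d \<in> D. Tr d = 0}"

text \<open>Two reflections with the same axis and the same determinant differ by a transvection with that axis.\<close>

lemma D_quotient:
  assumes "a \<in> D" "b \<in> D" "Tr b = Tr a"
  shows "(b - a) / (1 + Tr a) \<in> D0"
proof -
  have nz: "1 + Tr a \<noteq> 0" using D_det_nonzero[OF assms(1)] .
  have fix1: "frob r (1 + Tr a) = 1 + Tr a" using frob_det D_K[OF assms(1)] by blast
  have "b + - a / (1 + Tr a) + b * Tr (- a / (1 + Tr a)) \<in> D"
    by (intro D_mult D_inverse assms)
  also have "b + - a / (1 + Tr a) + b * Tr (- a / (1 + Tr a)) = (b - a) / (1 + Tr a)"
    using nz Tr_divide_fixed[OF fix1, of "- a"] by (simp add: field_simps)
  finally show ?thesis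
    using Tr_divide_fixed[OF fix1, of "b - a"] assms by (simp add: D0_def)
qed

lemma D0_add: "a \<in> D0 \<Longrightarrow> b \<in> D0 \<Longrightarrow> a + b \<in> D0"
  using D_mult[of a b] by (auto simp: D0_def)

lemma zero_in_D0: "0 \<in> D0"
  using scale[of 1] by (auto simp: D0_def D_def)

lemma D0_smult_nat: "a \<in> D0 \<Longrightarrow> of_nat m * a \<in> D0"
  by (induction m) (auto simp: algebra_simps zero_in_D0 intro: D0_add)

lemma D0_minus: "a \<in> D0 \<Longrightarrow> - a \<in> D0"
  using D_inverse[of a] by (auto simp: D0_def)

text \<open>Let \<open>t\<close> be the reflection with parameter \<open>a\<close> and \<open>R\<close> its conjugate under multiplication by \<open>l\<close>, so that
\<open>R x = x + l * a * Tr (x / l)\<close>. Then \<open>R t R\<^sup>-\<^sup>1\<close> is the reflection \<open>x + R a * Tr (b * x)\<close> with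
\<open>b = 1 - Tr (l * a) / (l * (1 + Tr a))\<close>, and conjugating with multiplication by \<open>b\<close> moves its axis back to the
kernel of the trace.\<close>

lemma D_conjugate:
  assumes a: "a \<in> D" and l: "l \<in> K" "l \<noteq> 0"
  shows "(1 - Tr (l * a) / (l * (1 + Tr a))) * (a + l * a * Tr (a / l)) \<in> D"
proof -
  define s where "s = 1 + Tr a"
  have s: "s \<noteq> 0" "frob r s = s" "Tr a = s - 1" "s \<in> K" and aK: "a \<in> K"
    using D_det_nonzero[OF a] frob_det[of a] D_K[OF a] by (auto simp: s_def)
  define R where "R x = x + l * a * Tr (x / l)" for x
  define R' where "R' x = x - l * a / s * Tr (x / l)" for x
  define b where "b = 1 - Tr (l * a) / (l * s)"
  have bK: "b \<in> K" using l s aK by (auto simp: b_def)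
  \<comment> \<open>If \<open>b = 0\<close>, then \<open>l\<close> would lie in the base field, and taking \<open>l\<close> out of \<open>Tr (l * a)\<close> gives \<open>Tr a = 1 + Tr a\<close>.\<close>
  have "b \<noteq> 0"
  proof
    assume "b = 0"
    hence "l = Tr (l * a) / s" using l s by (simp add: b_def field_simps)
    hence "frob r l = l" using s aK l frob_Tr[of "l * a"] by (metis K_closed(5) frob_simps(6))
    hence "Tr (l * a) = l * (s - 1)" using s by (simp add: Tr_smult)
    hence "l * s = l * (s - 1)" using \<open>l = Tr (l * a) / s\<close> s by (simp add: field_simps)
    thus False using l by simp
  qed
  have "(\<lambda>x. l * (x + a * Tr x)) \<in> F"
    using comp[OF scale[OF l] D_F[OF a]] .
  from comp[OF this scale[of "inverse l"]] have "(\<lambda>x. l * (inverse l * x + a * Tr (inverse l * x))) \<in> F"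
    using l by auto
  hence R: "R \<in> F"
    by (rule cong) (use l in \<open>simp add: R_def field_simps\<close>)
  have trl: "Tr (R x / l) = s * Tr (x / l)" if "x \<in> K" for x
  proof -
    have "R x / l = x / l + a * Tr (x / l)" using l by (simp add: R_def field_simps)
    hence "Tr (R x / l) = Tr (x / l) + (s - 1) * Tr (x / l)"
      using that l s(3) by (simp add: Tr_mult_Tr)
    thus ?thesis by (simp add: algebra_simps)
  qed
  have R': "R' \<in> F"
    by (rule inv[OF R]) (use trl s in \<open>simp add: R'_def\<close>, simp add: R_def)
  have R_lin: "R (x + c * y) = R x + c * R y" if "frob r c = c" for x y c
  proof -
    have "(x + c * y) / l = x / l + c * (y / l)" by (simp add: add_divide_distrib)
    hence "Tr ((x + c * y) / l) = Tr (x / l) + c * Tr (y / l)"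
      using that by (simp only: Tr_add Tr_smult)
    thus ?thesis by (simp only: R_def) (simp add: algebra_simps)
  qed
  have R'K: "R' x \<in> K" if "x \<in> K" for x using that l aK s by (auto simp: R'_def)
  have RR': "R (R' x) = x" if "x \<in> K" for x
  proof -
    have "R' x / l = x / l - a * (Tr (x / l) / s)" using l by (simp add: R'_def field_simps)
    moreover have "Tr (a * (Tr (x / l) / s)) = Tr a * (Tr (x / l) / s)"
      using Tr_smult[of "Tr (x / l) / s" a] that l s frob_Tr[of "x / l"] by (simp add: mult.commute)
    ultimately have "Tr (R' x / l) = Tr (x / l) - (s - 1) * (Tr (x / l) / s)"
      using s by simp
    also have "\<dots> = Tr (x / l) / s" using s by (simp add: field_simps)
    finally show ?thesis using s by (simp add: R_def R'_def)
  qed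
  have Tr_R': "Tr (R' x) = Tr (b * x)" if x: "x \<in> K" for x
  proof -
    have "Tr (l * a / s * Tr (x / l)) = Tr (l * a) / s * Tr (x / l)"
      using x l s aK Tr_mult_Tr[of "x / l" "l * a / s"] Tr_divide_fixed[of s "l * a"] by simp
    also have "\<dots> = Tr (Tr (l * a) / s * (x / l))"
      using s aK l frob_Tr[of "l * a"] by (subst Tr_smult) auto
    finally show ?thesis using l by (simp add: R'_def b_def algebra_simps)
  qed
  have "(\<lambda>x. R (R' x + a * Tr (R' x))) \<in> F"
    using comp[OF R comp[OF D_F[OF a] R']] .
  hence "(\<lambda>x. x + R a * Tr (b * x)) \<in> F"
  proof (rule cong)
    fix x assume x: "x \<in> K"
    show "R (R' x + a * Tr (R' x)) = x + R a * Tr (b * x)"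
      using R_lin[of "Tr (R' x)" "R' x" a] frob_Tr[OF R'K[OF x]] RR'[OF x] Tr_R'[OF x]
      by (simp add: mult.commute)
  qed
  from comp[OF scale[OF bK \<open>b \<noteq> 0\<close>] comp[OF this scale[of "inverse b"]]]
  have "(\<lambda>x. b * (inverse b * x + R a * Tr (b * (inverse b * x)))) \<in> F"
    using bK \<open>b \<noteq> 0\<close> by auto
  hence "(\<lambda>x. x + b * R a * Tr x) \<in> F"
    by (rule cong) (use \<open>b \<noteq> 0\<close> in \<open>simp add: field_simps\<close>)
  moreover have "b * R a \<in> K" using bK aK l by (auto simp: R_def)
  ultimately show ?thesis by (simp add: D_def b_def s_def R_def)
qed

text \<open>Up to the factor \<open>1 + Tr a\<close>, the difference between the parameter of the reflection in \<open>D_conjugate\<close> and \<open>a\<close>,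
multiplied out into terms that are products of traces of \<open>l * a\<close> and of \<open>a / l\<close>.\<close>

definition conjugation_defect :: "'l \<Rightarrow> 'l \<Rightarrow> 'l" where
  "conjugation_defect a l = (1 + Tr a) * (l * a) * Tr (a / l) - a / l * Tr (l * a) - a * Tr (l * a) * Tr (a / l)"

lemma conjugation_defect_in_D0:
  assumes a: "a \<in> D" and l: "l \<in> K" "l \<noteq> 0"
  shows "conjugation_defect a l / (1 + Tr a)\<^sup>2 \<in> D0"
proof -
  define s where "s = 1 + Tr a"
  have s: "s \<noteq> 0" "frob r s = s" "Tr a = s - 1" "s \<in> K" and aK: "a \<in> K"
    using D_det_nonzero[OF a] frob_det[of a] D_K[OF a] by (auto simp: s_def)
  define T T' where "T = Tr (l * a)" and "T' = Tr (a / l)"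
  have T: "frob r T = T" "frob r T' = T'"
    using frob_Tr[of "l * a"] frob_Tr[of "a / l"] aK l by (auto simp: T_def T'_def)
  define b where "b = (1 - T / (l * s)) * (a + l * a * T')"
  have b: "b \<in> D" using D_conjugate[OF a l] by (simp add: b_def s_def T_def T'_def)
  have eq: "s * (b - a) = conjugation_defect a l"
    using s l by (simp add: b_def conjugation_defect_def T_def T'_def field_simps)
  have "Tr (s * (b - a)) = Tr (s * T' * (l * a) - T * (a / l) - T * T' * a)"
    unfolding eq by (simp add: conjugation_defect_def s T_def T'_def mult_ac)
  also have "\<dots> = s * T' * T - T * T' - T * T' * (s - 1)"
  proof -
    have "frob r (s * T') = s * T'" "frob r (T * T') = T * T'" using T s by auto
    hence "Tr (s * T' * (l * a)) = s * T' * T" "Tr (T * (a / l)) = T * T'" "Tr (T * T' * a) = T * T' * (s - 1)"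
      using T s by (simp_all only: Tr_smult T_def T'_def)
    thus ?thesis by (simp only: Tr_diff)
  qed
  also have "\<dots> = 0" by (simp add: algebra_simps)
  finally have "Tr b = Tr a" using s by (simp add: Tr_smult)
  from D_quotient[OF a b this] have "(b - a) / s \<in> D0" by (simp add: s_def)
  moreover have "(b - a) / s = conjugation_defect a l / s\<^sup>2"
    unfolding eq[symmetric] using s by (simp add: power2_eq_square)
  ultimately show ?thesis by (simp add: s_def)
qed

text \<open>The expansion into characters of \<open>l\<close>. Writing the coefficients uniformly with conditionals, instead of as three
separate sums, lets the weighted sum over \<open>l\<close> be evaluated in a single application of \<open>trace_character_sum\<close>.\<close>

lemma conjugation_defect_expansion:
  "conjugation_defect a l = (\<Sum>j<n. \<Sum>i<n. ((if i = 0 then 1 + Tr a else 0) - (if j = 0 then 1 else 0) - a)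
            * (frob (r * i) a * frob (r * j) a * (frob (r * i) l / frob (r * j) l)))"
proof -
  define g where "g i j = frob (r * i) a * frob (r * j) a * (frob (r * i) l / frob (r * j) l)" for i j
  have 1: "Tr (l * a) * Tr (a / l) = (\<Sum>j<n. \<Sum>i<n. g i j)"
    unfolding Tr_def sum_product g_def by (subst sum.swap) (simp add: mult_ac)
  have 2: "l * a * Tr (a / l) = (\<Sum>j<n. \<Sum>i<n. if i = 0 then g i j else 0)"
    using n by (simp add: sum.delta Tr_def sum_distrib_left mult_ac g_def)
  have 3: "a / l * Tr (l * a) = (\<Sum>j<n. \<Sum>i<n. if j = 0 then g i j else 0)"
    using n by (subst sum.swap) (simp add: sum.delta Tr_def sum_distrib_left mult_ac g_def)
  have "conjugation_defect a l = (1 + Tr a) * (l * a * Tr (a / l)) - a / l * Tr (l * a) - a * (Tr (l * a) * Tr (a / l))"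
    by (simp add: conjugation_defect_def mult_ac)
  also have "\<dots> = (\<Sum>j<n. \<Sum>i<n. ((if i = 0 then 1 + Tr a else 0) - (if j = 0 then 1 else 0) - a) * g i j)"
    unfolding 1 2 3 sum_distrib_left sum_subtractf[symmetric]
    by (intro sum.cong refl) (auto simp: algebra_simps)
  finally show ?thesis by (simp only: g_def)
qed

text \<open>Dividing \<open>k\<close> by \<open>a * frob (r * s) a\<close> cancels the product of conjugates of \<open>a\<close> that accompanies the
character selected by the weight.\<close>

lemma weighted_conjugation_defect_sum:
  assumes a: "a \<in> K" "a \<noteq> 0" and k: "k \<in> K" and s: "s > 0" "s < n"
  shows "(\<Sum>l\<in>K-{0}. abs_tr (k / (a * frob (r * s) a) * l / frob (r * s) l) * conjugation_defect a l)
      = k + a * Tr k - (1 + Tr a) * frob (r * (n - s)) k"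
proof -
  define c where "c i j = ((if i = 0 then 1 + Tr a else 0) - (if j = 0 then 1 else 0) - a)
     * (frob (r * i) a * frob (r * j) a)" for i j :: nat
  define k' where "k' = k / (a * frob (r * s) a)"
  have k': "k' \<in> K" using a k by (auto simp: k'_def)
  have "(\<Sum>l\<in>K-{0}. abs_tr (k' * l / frob (r * s) l) * conjugation_defect a l)
      = (\<Sum>l\<in>K-{0}. \<Sum>j<n. \<Sum>i<n. c i j * (abs_tr (k' * l / frob (r * s) l) *
             (frob (r * i) l / frob (r * j) l)))"
    by (simp add: conjugation_defect_expansion sum_distrib_left c_def mult_ac)
  also have "\<dots> = (\<Sum>j<n. \<Sum>i<n. c i j * (\<Sum>l\<in>K-{0}. abs_tr (k' * l / frob (r * s) l) *
             (frob (r * i) l / frob (r * j) l)))"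
    by (subst sum.swap, rule sum.cong[OF refl], subst sum.swap) (simp add: sum_distrib_left)
  also have "\<dots> = (\<Sum>j<n. \<Sum>i<n. if i = (s + j) mod n then c i j * - frob (r * j) k' else 0)"
    by (intro sum.cong refl) (subst trace_character_sum[OF k' s], auto)
  also have "\<dots> = (\<Sum>j<n. c ((s + j) mod n) j * - frob (r * j) k')"
    using n by (subst sum.delta) auto
  also have "\<dots> = (\<Sum>j<n. (if j = 0 then k else 0) + a * frob (r * j) k
                 - (if j = n - s then (1 + Tr a) * frob (r * j) k else 0))"
  proof (rule sum.cong[OF refl])
    fix j assume j: "j \<in> {..<n}"
    have "frob (r * ((s + j) mod n)) a = frob (r * j) (frob (r * s) a)"
      using K_frob_mod[OF a(1), of "r * (s + j)"]
      by (simp add: mult_mod_right algebra_simps)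
    hence "frob (r * ((s + j) mod n)) a * frob (r * j) a * frob (r * j) k' = frob (r * j) k"
      using a by (simp add: k'_def)
    moreover have "(s + j) mod n = 0 \<longleftrightarrow> j = n - s"
    proof
      assume "(s + j) mod n = 0"
      then obtain m where "s + j = n * m" by auto
      moreover have "s + j < n * 2" "s + j > 0" using s j by auto
      ultimately have "m = 1" by (cases m; cases "m - 1") auto
      thus "j = n - s" using \<open>s + j = n * m\<close> by simp
    qed (use s in auto)
    ultimately show "c ((s + j) mod n) j * - frob (r * j) k' = (if j = 0 then k else 0) + a * frob (r * j) k
                 - (if j = n - s then (1 + Tr a) * frob (r * j) k else 0)"
      unfolding c_def by (auto simp: algebra_simps)
  qed
  also have "\<dots> = k + a * Tr k - (1 + Tr a) * frob (r * (n - s)) k"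
    using n s by (simp add: sum.distrib sum_subtractf sum.delta Tr_def sum_distrib_left)
  finally show ?thesis by (simp add: k'_def)
qed

text \<open>All weights are multiples of one, so the weighted sum stays inside the additive group \<open>D0\<close>, scaled by the
constant \<open>(1 + Tr a)\<^sup>2\<close>.\<close>

lemma twisted_difference_in_D0:
  assumes a: "a \<in> D" "a \<noteq> 0" and k: "k \<in> K" and s: "s > 0" "s < n"
  shows "((1 + Tr a) * frob (r * s) k - k - a * Tr k) / (1 + Tr a)\<^sup>2 \<in> D0"
proof -
  \<comment> \<open>The weight attached to \<open>n - s\<close> produces the twist by \<open>s\<close>.\<close>
  define t where "t = n - s"
  have t: "t > 0" "t < n" "n - t = s" using s by (auto simp: t_def)
  have aK: "a \<in> K" using D_K[OF a(1)] .
  define E where "E = {x. x / (1 + Tr a)\<^sup>2 \<in> D0}"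
  have E_add: "x + y \<in> E" if "x \<in> E" "y \<in> E" for x y
    using that D0_add by (auto simp: E_def add_divide_distrib)
  have E_sum: "sum f A \<in> E" if "\<And>x. x \<in> A \<Longrightarrow> f x \<in> E" for f :: "'l \<Rightarrow> 'l" and A
  proof -
    have "0 \<in> E" by (simp add: E_def zero_in_D0)
    thus ?thesis using that by (induction A rule: infinite_finite_induct) (auto intro: E_add)
  qed
  have "(\<Sum>l\<in>K-{0}. abs_tr (k / (a * frob (r * t) a) * l / frob (r * t) l) * conjugation_defect a l) \<in> E"
  proof (rule E_sum)
    fix l assume l: "l \<in> K - {0}"
    have "k / (a * frob (r * t) a) * l / frob (r * t) l \<in> K" using k aK l by auto
    then obtain m where "abs_tr (k / (a * frob (r * t) a) * l / frob (r * t) l) = of_nat m"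
      using abs_tr_is_of_nat by blast
    thus "abs_tr (k / (a * frob (r * t) a) * l / frob (r * t) l) * conjugation_defect a l \<in> E"
      using D0_smult_nat[OF conjugation_defect_in_D0[OF a(1)], of l m] l by (simp add: E_def)
  qed
  hence "(k + a * Tr k - (1 + Tr a) * frob (r * s) k) / (1 + Tr a)\<^sup>2 \<in> D0"
    using weighted_conjugation_defect_sum[OF aK a(2) k t(1,2)] t(3) by (simp add: E_def)
  from D0_minus[OF this] show ?thesis
    by (simp only: minus_divide_left minus_diff_eq minus_add_distrib diff_diff_eq)
qed

text \<open>With \<open>a = - 1\<close> and \<open>n = 2\<close> the reflection is \<open>x \<mapsto> - frob r x\<close>. It normalizes the group of multiplications,
and the group that they generate contains no transvection with axis the kernel of the trace other than the reflection itself
when \<open>p = 2\<close>, and none at all otherwise; so this exception is genuine.\<close>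

theorem trace_zero_in_D0:
  assumes a: "a \<in> D" "a \<noteq> 0" and n2: "n \<ge> 2" and ex: "\<not> (n = 2 \<and> a = -1)"
    and x: "x \<in> K" "Tr x = 0"
  shows "x \<in> D0"
proof -
  define s where "s = 1 + Tr a"
  have s: "s \<noteq> 0" "frob r s = s" "Tr a = s - 1" "s \<in> K" and aK: "a \<in> K"
    using D_det_nonzero[OF a(1)] frob_det[of a] D_K[OF a(1)] by (auto simp: s_def)
  have tw: "(s * frob (r * i) k - k - a * Tr k) / s\<^sup>2 \<in> D0" if "k \<in> K" "i > 0" "i < n" for i k
    using twisted_difference_in_D0[OF a that] by (simp add: s_def)
  have D0_diff: "u - v \<in> D0" if "u \<in> D0" "v \<in> D0" for u v
    using D0_add[OF that(1) D0_minus[OF that(2)]] by simp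
  consider (large) "n \<ge> 3" | (two) "n = 2" "s + 1 \<noteq> 0" | (invol) "n = 2" "s + 1 = 0"
    using n2 by linarith
  thus ?thesis
  proof cases
    case large
    obtain k where k: "k \<in> K" "s * x = k - frob r k"
      using trace_zero_is_coboundary[of "s * x"] x s by (auto simp: Tr_smult)
    obtain k1 where k1: "k1 \<in> K" "frob r k1 = k"
    proof
      show "frob (r * (n - 1)) k \<in> K" using k by auto
      have "r + r * (n - 1) = r * n" using n2 by (cases n) auto
      thus "frob r (frob (r * (n - 1)) k) = k" using k by simp
    qed
    \<comment> \<open>Subtracting the twists by one and by two removes the terms \<open>k1\<close> and \<open>a * Tr k1\<close>.\<close>
    have "(s * frob (r * 1) k1 - k1 - a * Tr k1) / s\<^sup>2 - (s * frob (r * 2) k1 - k1 - a * Tr k1) / s\<^sup>2 \<in> D0"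
      using large by (intro D0_diff tw k1) auto
    also have "(s * frob (r * 1) k1 - k1 - a * Tr k1) / s\<^sup>2 - (s * frob (r * 2) k1 - k1 - a * Tr k1) / s\<^sup>2
        = s * (frob r k1 - frob r (frob r k1)) / s\<^sup>2"
      by (simp add: diff_divide_distrib[symmetric] algebra_simps mult_2_right)
    also have "\<dots> = x" unfolding k1(2) k(2)[symmetric] using s by (simp add: power2_eq_square)
    finally show ?thesis .
  next
    case two
    define y where "y = s\<^sup>2 * x / (s + 1)"
    have fy: "frob r (s\<^sup>2 / (s + 1)) = s\<^sup>2 / (s + 1)" using s by simp
    have "Tr y = 0" using Tr_smult[OF fy, of x] x by (simp add: y_def)
    moreover have "y \<in> K" using x s by (auto simp: y_def)
    ultimately obtain k where k: "k \<in> K" "y = k - frob r k"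
      using trace_zero_is_coboundary by blast
    have fk: "frob r (frob r k) = k" using k two K_frob[of k] by (simp add: mult_2_right)
    have Trk: "Tr (frob r k) = Tr k"
      unfolding Tr_def using fk two(1) by (simp add: numeral_2_eq_2 add.commute)
    \<comment> \<open>Conjugate elements have the same trace, so only \<open>(s + 1) * (k - frob r k)\<close> survives.\<close>
    have "(s * frob (r * 1) (frob r k) - frob r k - a * Tr (frob r k)) / s\<^sup>2
        - (s * frob (r * 1) k - k - a * Tr k) / s\<^sup>2 \<in> D0"
    proof -
      have "1 < n" using two(1) by simp
      moreover have "frob r k \<in> K" using k(1) by blast
      ultimately show ?thesis using k(1) by (intro D0_diff tw) auto
    qed
    also have "(s * frob (r * 1) (frob r k) - frob r k - a * Tr (frob r k)) / s\<^sup>2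
        - (s * frob (r * 1) k - k - a * Tr k) / s\<^sup>2 = ((s + 1) * y) / s\<^sup>2"
      unfolding k(2) using fk Trk by (simp add: diff_divide_distrib[symmetric] algebra_simps)
    also have "\<dots> = x" using two s by (simp add: y_def)
    finally show ?thesis .
  next
    case invol
    \<comment> \<open>Now \<open>1 + Tr a = - 1\<close>, and the twisted difference is itself a trace times the constant \<open>c = - (1 + a)\<close>, which has trace zero; the elements of trace zero are the multiples of \<open>c\<close> over the base field.\<close>
    have s1: "s = - 1" using invol by (simp add: add_eq_0_iff2)
    define c where "c = - (1 + a)"
    have "c \<in> K" unfolding c_def using aK by auto
    moreover have "c \<noteq> 0" using ex invol by (auto simp: c_def eq_neg_iff_add_eq_0 add.commute)
    ultimately have c: "c \<noteq> 0" "c \<in> K" by auto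
    have TrK: "Tr u = u + frob r u" for u
      unfolding Tr_def using invol(1) by (simp add: numeral_2_eq_2)
    have "Tr c = 0"
    proof -
      have "Tr a + 1 + 1 = 0" using s(3) s1 by simp
      moreover have "Tr c = - (Tr a + 1 + 1)" unfolding TrK c_def by simp
      ultimately show ?thesis by simp
    qed
    hence fc: "frob r c = - c" by (simp add: TrK add_eq_0_iff)
    moreover have fx: "frob r x = - x" using x by (simp add: TrK add_eq_0_iff)
    ultimately have "frob r (x / c) = x / c" by simp
    then obtain k where k: "k \<in> K" "Tr k = x / c" using Tr_surj by blast
    have "(s * frob (r * 1) k - k - a * Tr k) / s\<^sup>2 \<in> D0"
      using invol k by (intro tw) auto
    also have "(s * frob (r * 1) k - k - a * Tr k) / s\<^sup>2 = - (frob r k + k) - a * Tr k"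
      using s1 by simp
    also have "\<dots> = c * Tr k" by (simp add: TrK c_def algebra_simps)
    also have "\<dots> = x" using k c by simp
    finally show ?thesis .
  qed
qed

end

section \<open>Transitivity of a Singer cycle on nonzero vectors\<close>

text \<open>Translation by one permutes the ring, so it leaves the sum of all elements unchanged.\<close>

lemma of_nat_CARD_eq_0: "of_nat (CARD('a)) = (0 :: 'a :: {ring_1, finite})"
proof -
  have "(\<Sum>x\<in>(UNIV :: 'a set). x) = (\<Sum>x\<in>UNIV. x + 1)"
    by (rule sum.reindex_bij_witness[of _ "\<lambda>x. x + 1" "\<lambda>x. x - 1"]) auto
  thus ?thesis by (simp add: sum.distrib)
qed

lemma funpow_linear:
  fixes c :: "'a::field ^ 'n ^ 'n"
  shows "((*v) c ^^ e) (v + w) = ((*v) c ^^ e) v + ((*v) c ^^ e) w"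
    "((*v) c ^^ e) (v - w) = ((*v) c ^^ e) v - ((*v) c ^^ e) w"
    "((*v) c ^^ e) (k *s v) = k *s ((*v) c ^^ e) v"
    "((*v) c ^^ e) 0 = 0"
  by (induction e) (auto simp: matrix_vector_right_distrib matrix_vector_mult_diff_distrib vector_scalar_commute)

lemma funpow_split: "i \<le> j \<Longrightarrow> (f ^^ j) x = (f ^^ i) ((f ^^ (j - i)) x)"
  by (metis comp_apply funpow_add le_add_diff_inverse)

lemma funpow_period: "(\<And>x. (f ^^ N) x = x) \<Longrightarrow> (f ^^ (N * m)) x = x"
  by (induction m) (simp_all add: funpow_add)

lemma funpow_period_inverse:
  assumes "\<And>x. (f ^^ N) x = x" "N > 0"
  shows "(f ^^ ((N - 1) * i)) ((f ^^ i) x) = x"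
proof -
  have "N * i = (N - 1) * i + i" using \<open>N > 0\<close> by (cases N) auto
  thus ?thesis using funpow_period[of N f i x, OF assms(1)] by (simp add: funpow_add)
qed

lemma funpow_invariant:
  assumes "\<And>v. v \<in> U \<Longrightarrow> f v \<in> U" "v \<in> U"
  shows "(f ^^ e) v \<in> U"
  using assms by (induction e) auto

text \<open>Modulo \<open>U\<close>, the map \<open>f\<close> acts on the span of \<open>w\<close> and \<open>x = f w - w\<close> as a unipotent map: \<open>(f ^^ j) w \<equiv> w + j x\<close>.
If \<open>(f ^^ N) w = w\<close> with \<open>N\<close> prime to the characteristic, then \<open>x\<close> vanishes modulo \<open>U\<close>.\<close>

lemma fixed_space_step:
  fixes f :: "'a::field ^ 'n \<Rightarrow> 'a ^ 'n"
  assumes add: "\<And>v w. f (v + w) = f v + f w" and U: "vec.subspace U" "\<And>v. v \<in> U \<Longrightarrow> f v \<in> U"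
    and unip: "f (f w - w) - (f w - w) \<in> U"
    and N: "(f ^^ N) w = w" "of_nat N \<noteq> (0::'a)"
  shows "f w - w \<in> U"
proof -
  define x where "x = f w - w"
  have fx: "f (of_nat j *s x) - of_nat j *s x \<in> U" for j
  proof (induction j)
    case 0
    have "f 0 = f 0 + f 0" using add[of 0 0] by simp
    thus ?case using U by (simp add: vec.subspace_0)
  next
    case (Suc j)
    have "of_nat (Suc j) *s x = x + of_nat j *s x" by (simp add: vec.scale_left_distrib)
    hence "f (of_nat (Suc j) *s x) - of_nat (Suc j) *s x = (f x - x) + (f (of_nat j *s x) - of_nat j *s x)"
      by (simp add: add algebra_simps)
    moreover have "f x - x \<in> U" using unip by (simp only: x_def)
    ultimately show ?case using vec.subspace_add[OF U(1) _ Suc] by (simp only:)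
  qed
  have "(f ^^ j) w - w - of_nat j *s x \<in> U" for j
  proof (induction j)
    case 0
    show ?case using U by (simp add: vec.subspace_0)
  next
    case (Suc j)
    define u where "u = (f ^^ j) w - w - of_nat j *s x"
    have "(f ^^ j) w = w + (of_nat j *s x + u)" by (simp add: u_def)
    hence "(f ^^ Suc j) w = f w + (f (of_nat j *s x) + f u)" by (simp add: add)
    moreover have "f w = w + x" by (simp add: x_def)
    moreover have "of_nat (Suc j) *s x = x + of_nat j *s x" by (simp add: vec.scale_left_distrib)
    ultimately have "(f ^^ Suc j) w - w - of_nat (Suc j) *s x = (f (of_nat j *s x) - of_nat j *s x) + f u"
      by (simp only:) simp
    moreover have "f u \<in> U" using Suc U by (simp only: u_def)
    ultimately show ?case using vec.subspace_add[OF U(1) fx[of j]] by (simp only:)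
  qed
  from this[of N] have "- (of_nat N *s x) \<in> U" using N by simp
  hence "(- inverse (of_nat N)) *s (- (of_nat N *s x)) \<in> U" using U by (intro vec.subspace_scale)
  thus ?thesis using N(2) by (simp add: x_def[symmetric])
qed

lemma iterate_moves_within:
  assumes U: "vec.subspace U" "\<And>v. v \<in> U \<Longrightarrow> c *v v \<in> U" and v: "((*v) c ^^ e) v - v \<in> U"
  shows "((*v) c ^^ (e * m)) v - v \<in> U"
proof (induction m)
  case (Suc m)
  have "((*v) c ^^ (e * Suc m)) v - v
      = ((*v) c ^^ e) (((*v) c ^^ (e * m)) v - v) + (((*v) c ^^ e) v - v)"
    by (simp add: funpow_add funpow_linear)
  also have "\<dots> \<in> U"
    by (rule vec.subspace_add[OF U(1) funpow_invariant[of U "(*v) c", OF U(2) Suc] v])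
  finally show ?case .
qed (use U in \<open>simp add: vec.subspace_0\<close>)

text \<open>If \<open>c ^ d\<close> is trivial on \<open>Y\<close> modulo \<open>U\<close> and \<open>c ^ e\<close> fixes \<open>v\<close> modulo \<open>Y\<close>, then \<open>c ^ (d * e)\<close> is
unipotent at \<open>v\<close> modulo \<open>U\<close>, and since its order is prime to the characteristic it is trivial there.\<close>

lemma relative_periods_multiply:
  fixes c :: "'a::field ^ 'n ^ 'n"
  assumes N: "\<And>v. ((*v) c ^^ N) v = v" "of_nat N \<noteq> (0::'a)"
    and U: "vec.subspace U" "\<And>v. v \<in> U \<Longrightarrow> c *v v \<in> U"
    and Y: "vec.subspace Y" "\<And>v. v \<in> Y \<Longrightarrow> c *v v \<in> Y"
    and d: "\<And>y. y \<in> Y \<Longrightarrow> ((*v) c ^^ d) y - y \<in> U" and e: "((*v) c ^^ e) v - v \<in> Y"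
  shows "((*v) c ^^ (d * e)) v - v \<in> U"
proof -
  define f where "f = ((*v) c ^^ (d * e))"
  have "f v - v \<in> Y"
    unfolding f_def using iterate_moves_within[OF Y e, of d] by (simp only: mult.commute)
  hence "f (f v - v) - (f v - v) \<in> U"
    unfolding f_def by (intro iterate_moves_within[OF U d])
  moreover have "(f ^^ N) v = v"
  proof -
    have "(f ^^ N) v = ((*v) c ^^ (d * e * N)) v" by (simp add: f_def funpow_mult mult.commute)
    thus ?thesis using funpow_period[of N "(*v) c" "d * e" v, OF N(1)] by (simp only: mult.commute)
  qed
  moreover have "f (x + y) = f x + f y" for x y by (simp only: f_def funpow_linear)
  moreover have "f x \<in> U" if "x \<in> U" for x
    unfolding f_def using funpow_invariant[of U "(*v) c", OF U(2) that] .
  ultimately have "f v - v \<in> U" using fixed_space_step[of f U v N] U(1) N(2) by metis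
  thus ?thesis by (simp only: f_def)
qed

text \<open>On a quotient \<open>W / U\<close> with \<open>m\<close> elements, an invertible linear map of order prime to the characteristic has order at
most \<open>m - 1\<close>. The statement is phrased without quotients, and with \<open>m = card W / card U\<close> multiplied out. The first
return of a coset \<open>w + U\<close> gives an exponent \<open>e\<close> within the bound; if \<open>c ^ e\<close> is not yet trivial on all of \<open>W / U\<close>,
its fixed vectors form an intermediate subspace, and the bounds for the two steps multiply.\<close>

lemma relative_order_bound:
  fixes c :: "'a::{field,finite} ^ 'n ^ 'n"
  assumes N: "\<And>v. ((*v) c ^^ N) v = v" "of_nat N \<noteq> (0::'a)"
    and U: "vec.subspace U" "\<And>v. v \<in> U \<Longrightarrow> c *v v \<in> U"
    and W: "vec.subspace W" "\<And>v. v \<in> W \<Longrightarrow> c *v v \<in> W" and UW: "U \<subset> W"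
  shows "\<exists>e>0. e * card U \<le> card W - card U \<and> (\<forall>v\<in>W. ((*v) c ^^ e) v - v \<in> U)"
  using U W UW
proof (induction "card W - card U" arbitrary: U W rule: less_induct)
  case less
  note U = less.prems(1,2) and W = less.prems(3,4) and UW = less.prems(5)
  have fin: "finite (S)" for S :: "('a ^ 'n) set" by (rule finite_subset[OF subset_UNIV]) simp
  have UcW: "card U < card W" using UW by (intro psubset_card_mono fin)
  obtain w where w: "w \<in> W" "w \<notin> U" using UW by blast
  have "N > 0" using N(2) by (intro Nat.gr0I) auto
  define e where "e = (LEAST e. e > 0 \<and> ((*v) c ^^ e) w - w \<in> U)"
  have ex: "N > 0 \<and> ((*v) c ^^ N) w - w \<in> U" using \<open>N > 0\<close> N(1) U by (simp add: vec.subspace_0)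
  have e: "e > 0" "((*v) c ^^ e) w - w \<in> U" unfolding e_def using LeastI[where P="\<lambda>e. e > 0 \<and> ((*v) c ^^ e) w - w \<in> U", OF ex] by auto
  have e_min: "((*v) c ^^ d) w - w \<notin> U" if "0 < d" "d < e" for d
    using not_less_Least[where P="\<lambda>e. e > 0 \<and> ((*v) c ^^ e) w - w \<in> U", of d] that unfolding e_def by auto
  \<comment> \<open>As \<open>c\<close> has finite order, its powers also reflect membership in \<open>U\<close>; so no vector of the orbit of \<open>w\<close> lies in \<open>U\<close>.\<close>
  have stay: "v \<in> U" if "((*v) c ^^ i) v \<in> U" for i v
  proof -
    have "((*v) c ^^ ((N - 1) * i)) (((*v) c ^^ i) v) \<in> U"
      by (rule funpow_invariant[OF U(2) that])
    thus ?thesis by (simp only: funpow_period_inverse[where f="(*v) c", OF N(1) \<open>N > 0\<close>])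
  qed
  \<comment> \<open>The cosets of the first \<open>e\<close> points of the orbit are disjoint subsets of \<open>W - U\<close>.\<close>
  define C where "C i = (\<lambda>u. ((*v) c ^^ i) w + u) ` U" for i
  have C_sub: "C i \<subseteq> W - U" for i
  proof
    fix x assume "x \<in> C i"
    then obtain u where u: "u \<in> U" "x = ((*v) c ^^ i) w + u" by (auto simp: C_def)
    have "((*v) c ^^ i) w \<in> W" using funpow_invariant[OF W(2) w(1)] .
    moreover have "u \<in> W" using u(1) UW by blast
    ultimately have "x \<in> W" unfolding u(2) by (rule vec.subspace_add[OF W(1)])
    moreover have "x \<notin> U"
    proof
      assume "x \<in> U"
      hence "x - u \<in> U" using u(1) by (rule vec.subspace_diff[OF U(1)])
      thus False using stay[of i w] w(2) u(2) by simp
    qed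
    ultimately show "x \<in> W - U" by blast
  qed
  have card_C: "card (C i) = card U" for i unfolding C_def by (rule card_image) auto
  have disj: "C i \<inter> C j = {}" if "i < j" "j < e" for i j
  proof (rule ccontr)
    assume "C i \<inter> C j \<noteq> {}"
    then obtain u u' where u: "u \<in> U" "u' \<in> U" "((*v) c ^^ i) w + u = ((*v) c ^^ j) w + u'" by (auto simp: C_def)
    have "((*v) c ^^ j) w = ((*v) c ^^ i) (((*v) c ^^ (j - i)) w)"
      using that by (intro funpow_split) simp
    hence "((*v) c ^^ i) (((*v) c ^^ (j - i)) w - w) = ((*v) c ^^ j) w - ((*v) c ^^ i) w"
      by (simp only: funpow_linear)
    also have "\<dots> = u - u'"
    proof -
      have "((*v) c ^^ j) w = ((*v) c ^^ i) w + u - u'" unfolding u(3) by simp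
      thus ?thesis by simp
    qed
    finally have "((*v) c ^^ i) (((*v) c ^^ (j - i)) w - w) = u - u'" .
    hence "((*v) c ^^ (j - i)) w - w \<in> U" using stay u U by (metis vec.subspace_diff)
    thus False using e_min[of "j - i"] that by simp
  qed
  have disj': "C i \<inter> C j = {}" if "i \<noteq> j" "i < e" "j < e" for i j
    using disj[of i j] disj[of j i] that by (cases i j rule: linorder_cases) (simp_all add: Int_commute)
  have "e * card U = (\<Sum>i<e. card (C i))" by (simp add: card_C)
  also have "\<dots> = card (\<Union>i<e. C i)"
    by (rule card_UN_disjoint[symmetric]) (use disj' in \<open>simp_all add: fin\<close>)
  also have "\<dots> \<le> card (W - U)" using C_sub by (intro card_mono fin) auto
  also have "\<dots> = card W - card U" using UW by (intro card_Diff_subset fin) auto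
  finally have bound: "e * card U \<le> card W - card U" .
  define Y where "Y = {v \<in> W. ((*v) c ^^ e) v - v \<in> U}"
  have Y: "vec.subspace Y"
    unfolding vec.subspace_def
  proof (intro conjI ballI allI)
    show "0 \<in> Y" using U W by (simp add: Y_def funpow_linear vec.subspace_0)
  next
    fix x y assume xy: "x \<in> Y" "y \<in> Y"
    have "((*v) c ^^ e) (x + y) - (x + y) = (((*v) c ^^ e) x - x) + (((*v) c ^^ e) y - y)"
      by (simp add: funpow_linear)
    also have "\<dots> \<in> U" using xy by (intro vec.subspace_add[OF U(1)]) (simp_all add: Y_def)
    finally show "x + y \<in> Y" using xy vec.subspace_add[OF W(1)] by (simp add: Y_def)
  next
    fix k x assume x: "x \<in> Y"
    have "((*v) c ^^ e) (k *s x) - k *s x = k *s (((*v) c ^^ e) x - x)"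
      by (simp add: funpow_linear vec.scale_right_diff_distrib)
    also have "\<dots> \<in> U" using x by (intro vec.subspace_scale[OF U(1)]) (simp add: Y_def)
    finally show "k *s x \<in> Y" using x vec.subspace_scale[OF W(1)] by (simp add: Y_def)
  qed
  have Yc: "c *v v \<in> Y" if "v \<in> Y" for v
  proof -
    have "((*v) c ^^ e) (c *v v) - c *v v = c *v (((*v) c ^^ e) v - v)"
      by (simp add: matrix_vector_mult_diff_distrib funpow_swap1)
    thus ?thesis using that U(2) W(2) by (simp add: Y_def)
  qed
  show ?case
  proof (cases "Y = W")
    case True
    thus ?thesis using e(1) bound by (auto simp: Y_def)
  next
    case False
    have "U \<subseteq> Y"
      using UW vec.subspace_diff[OF U(1) funpow_invariant[of U "(*v) c", OF U(2)]] by (auto simp: Y_def)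
    moreover have "w \<in> Y" using w e by (simp add: Y_def)
    ultimately have UY: "U \<subset> Y" and YW: "Y \<subset> W" using w False by (auto simp: Y_def)
    have c1: "card U < card Y" "card Y < card W" using UY YW by (auto intro!: psubset_card_mono fin)
    obtain e1 where e1: "e1 > 0" "e1 * card U \<le> card Y - card U" "\<And>v. v \<in> Y \<Longrightarrow> ((*v) c ^^ e1) v - v \<in> U"
    proof -
      have "card Y - card U < card W - card U" using c1 by linarith
      from less.hyps[OF this U Y Yc UY] show thesis using that by blast
    qed
    obtain e2 where e2: "e2 > 0" "e2 * card Y \<le> card W - card Y" "\<And>v. v \<in> W \<Longrightarrow> ((*v) c ^^ e2) v - v \<in> Y"
    proof -
      have "card W - card Y < card W - card U" using c1 by linarith
      from less.hyps[OF this Y Yc W YW] show thesis using that by blast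
    qed
    have "(e1 * e2) * card U \<le> e2 * card Y"
    proof -
      have "e1 * card U \<le> card Y" using e1(2) by linarith
      hence "e2 * (e1 * card U) \<le> e2 * card Y" by (rule mult_le_mono2)
      thus ?thesis by (simp only: mult_ac)
    qed
    also have "\<dots> \<le> card W - card U" using e2(2) c1 by linarith
    finally have "(e1 * e2) * card U \<le> card W - card U" .
    moreover have "((*v) c ^^ (e1 * e2)) v - v \<in> U" if "v \<in> W" for v
      using relative_periods_multiply[OF N U Y Yc e1(3) e2(3)[OF that]] .
    ultimately show ?thesis using e1(1) e2(1) by (intro exI[of _ "e1 * e2"]) auto
  qed
qed

text \<open>An invariant subspace different from \<open>{0}\<close> and the whole space would, by \<open>relative_order_bound\<close> applied below and above it,
make the order of \<open>c\<close> smaller than \<open>q ^ n - 1\<close>. So there is none; hence a power of \<open>c\<close> that fixes one nonzero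
vector is the identity, and the orbit of \<open>v\<close> has \<open>q ^ n - 1\<close> elements.\<close>

lemma powers_act_transitively:
  fixes c :: "'a::{field,finite} ^ 'n ^ 'n"
  assumes ord: "\<And>j. (\<forall>v. ((*v) c ^^ j) v = v) \<longleftrightarrow> CARD('a) ^ CARD('n) - 1 dvd j"
    and v: "v \<noteq> 0" and w: "w \<noteq> 0"
  shows "\<exists>j. ((*v) c ^^ j) v = w"
proof -
  define N where "N = CARD('a) ^ CARD('n) - 1"
  have fin: "finite (S)" for S :: "('a ^ 'n) set" by (rule finite_subset[OF subset_UNIV]) simp
  have "card {0::'a, 1} \<le> CARD('a)" by (intro card_mono) auto
  hence q2: "CARD('a) \<ge> 2" by simp
  have "CARD('a) ^ CARD('n) \<ge> CARD('a) ^ 1" using q2 by (intro power_increasing) (auto simp: Suc_leI)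
  hence Q: "CARD('a) ^ CARD('n) \<ge> 2" using q2 by simp
  have cN: "((*v) c ^^ N) x = x" for x using ord[of N] by (simp add: N_def)
  have "of_nat (CARD('a)) = (0::'a)" by (rule of_nat_CARD_eq_0)
  hence "of_nat (CARD('a) ^ CARD('n)) = (0::'a)" by simp
  hence N0: "of_nat N = (-1::'a)" using Q unfolding N_def by (subst of_nat_diff) auto
  \<comment> \<open>The relative exponents for \<open>{0} \<subset> Y\<close> and \<open>Y \<subset> UNIV\<close> multiply to a period of \<open>c\<close> that is smaller than \<open>N\<close>.\<close>
  have irred: "Y = UNIV" if Y: "vec.subspace Y" "\<And>v. v \<in> Y \<Longrightarrow> c *v v \<in> Y" "x \<in> Y" "x \<noteq> 0" for Y x
  proof (rule ccontr)
    assume "Y \<noteq> UNIV"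
    have z: "vec.subspace {0::'a^'n}" by (rule vec.subspace_single_0)
    have "{0} \<subset> Y" using Y vec.subspace_0[of Y] by auto
    then obtain e1 where e1: "e1 > 0" "e1 * card {0::'a^'n} \<le> card Y - card {0::'a^'n}" "\<forall>v\<in>Y. ((*v) c ^^ e1) v - v \<in> {0}"
      using relative_order_bound[of N c "{0}" Y] cN N0 z Y by auto
    have "Y \<subset> UNIV" using \<open>Y \<noteq> UNIV\<close> by blast
    then obtain e2 where e2: "e2 > 0" "e2 * card Y \<le> card (UNIV::('a^'n) set) - card Y" "\<forall>v. ((*v) c ^^ e2) v - v \<in> Y"
      using relative_order_bound[of N c Y UNIV] cN N0 Y vec.subspace_UNIV by auto
    have cY: "card Y < card (UNIV::('a^'n) set)" using \<open>Y \<subset> UNIV\<close> by (rule psubset_card_mono[OF fin])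
    have "((*v) c ^^ (e1 * e2)) v = v" for v
    proof -
      have "((*v) c ^^ (e1 * e2)) v - v \<in> {0}"
        by (rule relative_periods_multiply[of N c "{0}" Y]) (use cN N0 z Y e1(3) e2(3) in auto)
      thus ?thesis by simp
    qed
    hence "N dvd e1 * e2" using ord[of "e1 * e2"] by (simp add: N_def)
    hence "N \<le> e1 * e2" using e1(1) e2(1) by (intro dvd_imp_le) auto
    moreover have "e1 * e2 \<le> e2 * card Y"
    proof -
      have "e1 \<le> card Y" using e1(2) by simp
      thus ?thesis by (simp add: mult.commute)
    qed
    ultimately have "N \<le> card (UNIV :: ('a^'n) set) - card Y" using e2(2) by linarith
    moreover have "1 < card Y" using psubset_card_mono[OF fin \<open>{0} \<subset> Y\<close>] by simp
    moreover have "N = card (UNIV :: ('a^'n) set) - 1" by (simp add: N_def)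
    ultimately show False using cY by linarith
  qed
  have free: "N dvd j" if "((*v) c ^^ j) v = v" for j
  proof -
    define Y where "Y = {x. ((*v) c ^^ j) x = x}"
    have "vec.subspace Y" by (auto simp: Y_def vec.subspace_def funpow_linear)
    moreover have "c *v x \<in> Y" if "x \<in> Y" for x
      using that by (simp add: Y_def flip: funpow_swap1[of "(*v) c"])
    ultimately have "Y = UNIV" using irred[of Y v] that v by (auto simp: Y_def)
    thus ?thesis using ord[of j] by (auto simp: Y_def N_def)
  qed
  have inj_c: "x = 0" if "((*v) c ^^ j) x = 0" for j x
  proof -
    have "N > 0" using Q by (simp add: N_def)
    from funpow_period_inverse[where f="(*v) c", OF cN this, of j x]
    have "x = ((*v) c ^^ ((N - 1) * j)) (((*v) c ^^ j) x)" by simp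
    thus ?thesis using that by (simp add: funpow_linear)
  qed
  have "inj_on (\<lambda>j. ((*v) c ^^ j) v) {..<N}"
  proof (rule linorder_inj_onI')
    fix i j assume ij: "i \<in> {..<N}" "j \<in> {..<N}" "i < j"
    show "((*v) c ^^ i) v \<noteq> ((*v) c ^^ j) v"
    proof
      assume eq: "((*v) c ^^ i) v = ((*v) c ^^ j) v"
      have "((*v) c ^^ j) v = ((*v) c ^^ i) (((*v) c ^^ (j - i)) v)"
        using ij by (intro funpow_split) simp
      hence "((*v) c ^^ i) (((*v) c ^^ (j - i)) v - v) = 0" using eq by (simp add: funpow_linear)
      hence "((*v) c ^^ (j - i)) v = v" using inj_c by fastforce
      hence "N dvd j - i" by (rule free)
      thus False using ij by (auto dest: dvd_imp_le)
    qed
  qed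
  hence "card ((\<lambda>j. ((*v) c ^^ j) v) ` {..<N}) = N" by (simp add: card_image)
  moreover have "(\<lambda>j. ((*v) c ^^ j) v) ` {..<N} \<subseteq> UNIV - {0}"
  proof
    fix x assume "x \<in> (\<lambda>j. ((*v) c ^^ j) v) ` {..<N}"
    then obtain j where "x = ((*v) c ^^ j) v" by blast
    thus "x \<in> UNIV - {0}" using inj_c[of j v] v by auto
  qed
  moreover have "card (UNIV - {0::'a^'n}) = N" by (simp add: card_Diff_singleton N_def)
  ultimately have "(\<lambda>j. ((*v) c ^^ j) v) ` {..<N} = UNIV - {0}" by (intro card_subset_eq fin) auto
  moreover have "w \<in> UNIV - {0}" using w by simp
  ultimately obtain j where "w = ((*v) c ^^ j) v" by blast
  thus ?thesis by blast
qed

section \<open>The field model of a Singer cycle\<close>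

text \<open>By Sylow's theorem every prime divisor of the order is the order of a subgroup of the additive group, whose nonzero elements
are killed by that prime; so it is the characteristic.\<close>

lemma CARD_field_prime_power:
  obtains p r where "prime p" "CARD('a :: {field, finite}) = p ^ r" "semiring_char TYPE('a) = p" "r > 0"
proof -
  define p where "p = semiring_char TYPE('a)"
  have q0: "of_nat (CARD('a)) = (0 :: 'a)" by (rule of_nat_CARD_eq_0)
  have "p > 0" using q0 zero_less_card_finite[where 'a='a] unfolding p_def CHAR_pos_iff by blast
  hence p: "prime p" using prime_CHAR_semidom unfolding p_def by blast
  define G :: "'a monoid" where "G = \<lparr>carrier = UNIV, mult = (+), one = 0\<rparr>"
  interpret G: group G
    by (rule groupI) (auto simp: G_def add.assoc intro: exI[of _ "- _"])
  have pow: "x [^]\<^bsub>G\<^esub> (m::nat) = of_nat m * x" for x m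
    by (induction m) (auto simp: G_def nat_pow_def algebra_simps)
  have "l = p" if l: "prime l" "l dvd CARD('a)" for l
  proof -
    obtain m where "order G = l ^ 1 * m" using l by (auto simp: G_def Coset.order_def)
    then obtain H where H: "subgroup H G" "card H = l"
      using sylow_thm[OF l(1) G.is_group, of 1 m] by (auto simp: G_def)
    interpret H: group "G\<lparr>carrier := H\<rparr>" using H(1) by (rule subgroup.subgroup_is_group) (rule G.is_group)
    have "H \<noteq> {0}" using H(2) l(1) by auto
    moreover have "0 \<in> H" using subgroup.one_closed[OF H(1)] by (simp add: G_def)
    ultimately obtain x where x: "x \<in> H" "x \<noteq> 0" by blast
    have "x [^]\<^bsub>G\<lparr>carrier := H\<rparr>\<^esub> order (G\<lparr>carrier := H\<rparr>) = \<one>\<^bsub>G\<lparr>carrier := H\<rparr>\<^esub>"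
      using x by (intro H.pow_order_eq_1) auto
    hence "of_nat l * x = 0"
      using H(2) pow by (simp add: Coset.order_def nat_pow_def) (simp add: G_def)
    hence "p dvd l" using x by (simp add: of_nat_eq_0_iff_char_dvd p_def)
    thus "l = p" using primes_dvd_imp_eq[OF p l(1)] by simp
  qed
  hence sub: "prime_factors CARD('a) \<subseteq> {p}" by auto
  have "card {0::'a, 1} \<le> CARD('a)" by (intro card_mono) auto
  hence "CARD('a) \<noteq> 1" by simp
  have "CARD('a) = (\<Prod>l\<in>prime_factors CARD('a). l ^ multiplicity l CARD('a))"
    using prod_prime_factors[of "CARD('a)"] by simp
  moreover have "prime_factors CARD('a) \<noteq> {}"
    using calculation \<open>CARD('a) \<noteq> 1\<close> by (metis prod.empty)
  moreover define k where "k = multiplicity p CARD('a)"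
  ultimately have k: "CARD('a) = p ^ k"
    using sub by (simp add: subset_singleton_iff)
  moreover have "k > 0" using k \<open>CARD('a) \<noteq> 1\<close> by (intro Nat.gr0I) simp
  ultimately show ?thesis using that[OF p _ p_def[symmetric]] by blast
qed

lemma GL_pow_apply: "(c [^]\<^bsub>GL\<^esub> j) *v v = ((*v) c ^^ j) v" for c :: "'a::field ^ 'n ^ 'n"
proof (induction j arbitrary: v)
  case 0
  show ?case by (simp add: GL_def nat_pow_def)
next
  case (Suc j)
  have "c [^]\<^bsub>GL\<^esub> Suc j = (c [^]\<^bsub>GL\<^esub> j) ** c" by (simp add: GL_def nat_pow_def)
  thus ?case using Suc by (simp add: funpow_swap1 flip: matrix_vector_mul_assoc)
qed

lemma singer_cycle_period:
  fixes c :: "'a::{field, finite} ^ 'n ^ 'n"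
  assumes "singer_cycle c"
  shows "(\<forall>v. ((*v) c ^^ j) v = v) \<longleftrightarrow> CARD('a) ^ CARD('n) - 1 dvd j"
proof -
  interpret GL: group "GL :: ('a ^ 'n ^ 'n) monoid" by (rule group_GL)
  have "(\<forall>v. ((*v) c ^^ j) v = v) \<longleftrightarrow> (\<forall>v. (c [^]\<^bsub>GL\<^esub> j) *v v = mat 1 *v v)"
    by (simp add: GL_pow_apply)
  also have "\<dots> \<longleftrightarrow> c [^]\<^bsub>GL\<^esub> j = \<one>\<^bsub>GL\<^esub>" unfolding matrix_eq[symmetric] by (simp add: GL_def)
  also have "\<dots> \<longleftrightarrow> CARD('a) ^ CARD('n) - 1 dvd j"
    using assms by (simp add: GL.pow_eq_id singer_cycle_def)
  finally show ?thesis .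
qed

definition field_linear :: "('a::field ^ 'n \<Rightarrow> 'a alg_closure) \<Rightarrow> bool" where
  "field_linear f \<longleftrightarrow> (\<forall>v w. f (v + w) = f v + f w) \<and> (\<forall>k v. f (k *s v) = to_ac k * f v)"

text \<open>The sum is the value of the polynomial \<open>f\<close> at the transpose of \<open>c\<close>, applied to the functional \<open>g\<close>. Splitting a linear factor
\<open>x - z\<close> off \<open>f\<close>, either the remaining factor still annihilates \<open>g\<close>, or it maps \<open>g\<close> to an eigenfunctional with eigenvalue
\<open>z\<close>.\<close>

lemma eigenfunctional_of_annihilating_poly:
  fixes c :: "'a::field ^ 'n ^ 'n" and f :: "'a alg_closure poly"
  assumes "f \<noteq> 0" "field_linear g" "g v0 \<noteq> 0"
    and "\<And>v. (\<Sum>k<Suc (degree f). coeff f k * g (((*v) c ^^ k) v)) = 0"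
  shows "\<exists>h w. field_linear h \<and> (\<exists>v. h v \<noteq> 0) \<and> (\<forall>v. h (c *v v) = w * h v)"
  using assms
proof (induction "degree f" arbitrary: f)
  case 0
  have "coeff f 0 * g v0 = 0" using 0(5)[of v0] by (simp flip: 0(1))
  moreover have "coeff f 0 \<noteq> 0" using 0(1,2) leading_coeff_0_iff[of f] by simp
  ultimately show ?case using 0 by simp
next
  case (Suc m f)
  then obtain z where "poly f z = 0" using alg_closed_imp_poly_has_root[of f] by auto
  then obtain g' where f: "f = [:- z, 1:] * g'" by (auto simp: poly_eq_0_iff_dvd)
  have "g' \<noteq> 0" using f Suc.prems by auto
  have "degree f = Suc (degree g')" unfolding f using \<open>g' \<noteq> 0\<close> by (subst degree_mult_eq) auto
  hence m: "m = degree g'" using Suc.hyps by simp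
  define h where "h v = (\<Sum>k<Suc m. coeff g' k * g (((*v) c ^^ k) v))" for v
  show ?case
  proof (cases "\<forall>v. h v = 0")
    case True
    thus ?thesis using Suc.hyps(1)[OF m \<open>g' \<noteq> 0\<close> Suc.prems(2,3)] by (simp add: h_def m)
  next
    case False
    have "field_linear h" using Suc.prems(2)
      by (simp add: field_linear_def h_def funpow_linear sum.distrib sum_distrib_left algebra_simps)
    moreover have "h (c *v v) = z * h v" for v
    proof -
      have fk: "coeff f (Suc k) = coeff g' k - z * coeff g' (Suc k)" "coeff f 0 = - z * coeff g' 0" for k
        unfolding f by (simp_all add: coeff_pCons)
      have "0 = (\<Sum>k<Suc (Suc m). coeff f k * g (((*v) c ^^ k) v))"
        using Suc.prems(4)[of v] Suc.hyps(2) by simp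
      also have "\<dots> = coeff f 0 * g v + (\<Sum>k<Suc m. coeff f (Suc k) * g (((*v) c ^^ Suc k) v))"
        by (subst sum.lessThan_Suc_shift) simp
      also have "\<dots> = (\<Sum>k<Suc m. coeff g' k * g (((*v) c ^^ k) (c *v v)))
          - z * (coeff g' 0 * g v + (\<Sum>k<Suc m. coeff g' (Suc k) * g (((*v) c ^^ Suc k) v)))"
        unfolding fk funpow_Suc_right comp_def
        by (simp only: left_diff_distrib sum_subtractf sum_distrib_left distrib_left mult.assoc) (simp add: algebra_simps)
      also have "coeff g' 0 * g v + (\<Sum>k<Suc m. coeff g' (Suc k) * g (((*v) c ^^ Suc k) v))
          = (\<Sum>k<Suc (Suc m). coeff g' k * g (((*v) c ^^ k) v))"
        by (subst (2) sum.lessThan_Suc_shift) simp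
      also have "\<dots> = h v" by (simp add: h_def coeff_eq_0 m)
      finally show ?thesis by (simp add: h_def)
    qed
    ultimately show ?thesis using False by blast
  qed
qed

text \<open>An identification \<open>\<Phi>\<close> of the space with the field \<open>K\<close> under which \<open>c\<close> becomes multiplication by the generator \<open>w\<close>.\<close>

locale singer_field_model = finite_field_extension p r n w
  for p r n :: nat and w :: "'a::{field, finite} alg_closure" +
  fixes c :: "'a ^ 'n ^ 'n" and \<Phi> :: "'a ^ 'n \<Rightarrow> 'a alg_closure"
  assumes q: "CARD('a) = p ^ r" and n_def: "n = CARD('n)"
    and \<Phi>_add: "\<Phi> (v + v') = \<Phi> v + \<Phi> v'" and \<Phi>_scale: "\<Phi> (k *s v) = to_ac k * \<Phi> v"
    and \<Phi>_inj: "\<Phi> v = \<Phi> v' \<longleftrightarrow> v = v'" and \<Phi>_range: "range \<Phi> = K"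
    and \<Phi>_c: "\<Phi> (c *v v) = w * \<Phi> v"

text \<open>The identification is an eigenfunctional of \<open>c\<close> over the algebraic closure, normalized to take the value one somewhere. Its
kernel is invariant under \<open>c\<close>, hence zero by transitivity, and transitivity also shows that its nonzero values are exactly
the powers of the eigenvalue.\<close>

theorem singer_cycle_field_model:
  fixes c :: "'a::{field, finite} ^ 'n ^ 'n"
  assumes "singer_cycle c"
  shows "\<exists>p r w \<Phi>. singer_field_model p r CARD('n) w c \<Phi>"
proof -
  obtain p r where p: "prime p" "CARD('a) = p ^ r" "semiring_char TYPE('a) = p" "r > 0"
    by (rule CARD_field_prime_power)
  define N where "N = CARD('a) ^ CARD('n) - 1"
  note period = singer_cycle_period[OF assms]
  have cN: "((*v) c ^^ N) v = v" for v using period[of N] by (simp add: N_def)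
  have trans: "\<exists>j. ((*v) c ^^ j) v = v'" if "v \<noteq> 0" "v' \<noteq> 0" for v v'
    using powers_act_transitively[OF period that] .
  have "p ^ r \<ge> p ^ 1" using p(4) prime_ge_1_nat[OF p(1)] by (intro power_increasing) auto
  hence q2: "CARD('a) \<ge> 2" using p prime_ge_2_nat[OF p(1)] by simp
  have "CARD('a) ^ CARD('n) \<ge> CARD('a) ^ 1" using q2 by (intro power_increasing) (auto simp: Suc_leI)
  hence N: "N > 0" using q2 by (simp add: N_def)
  fix i0 :: 'n
  define g :: "'a ^ 'n \<Rightarrow> 'a alg_closure" where "g v = to_ac (v $ i0)" for v
  \<comment> \<open>The polynomial \<open>x ^ N - 1\<close> annihilates \<open>c\<close> and hence any coordinate functional.\<close>
  define f :: "'a alg_closure poly" where "f = monom 1 N - 1"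
  have coeff_f: "coeff f k = (if k = N then 1 else 0) - (if k = 0 then 1 else 0)" for k
    by (auto simp: f_def)
  have "coeff f N = 1" using N by (simp add: coeff_f)
  hence f0: "f \<noteq> 0" and "degree f \<ge> N" by (auto intro: le_degree)
  moreover have "degree f \<le> N" unfolding f_def by (intro degree_diff_le degree_monom_le) auto
  ultimately have deg: "degree f = N" by simp
  have "(\<Sum>k<Suc (degree f). coeff f k * g (((*v) c ^^ k) v)) = 0" for v
    using N cN by (simp add: deg coeff_f left_diff_distrib sum_subtractf
      if_distrib[where f="\<lambda>x. x * _"] sum.delta sum.delta' cong: if_cong)
  moreover have "field_linear g" by (simp add: field_linear_def g_def)
  moreover have "g (axis i0 1) \<noteq> 0" by (simp add: g_def axis_def)
  ultimately obtain h w where h: "field_linear h" "\<exists>v. h v \<noteq> 0" "\<And>v. h (c *v v) = w * h v"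
    using eigenfunctional_of_annihilating_poly[OF f0, of g "axis i0 1" c] by blast
  have h_add: "h (v + v') = h v + h v'" for v v' using h(1) by (simp add: field_linear_def)
  have h_scale: "h (k *s v) = to_ac k * h v" for k v using h(1) by (simp add: field_linear_def)
  have h0: "h 0 = 0" using h_scale[of 0 0] by simp
  have h_pow: "h (((*v) c ^^ j) v) = w ^ j * h v" for j v by (induction j) (auto simp: h(3))
  have h_ker: "v = 0" if "h v = 0" for v
  proof (rule ccontr)
    assume "v \<noteq> 0"
    obtain u where u: "h u \<noteq> 0" using h(2) by blast
    hence "u \<noteq> 0" using h0 by auto
    then obtain j where "u = ((*v) c ^^ j) v" using trans[OF \<open>v \<noteq> 0\<close>] by metis
    thus False using u h_pow[of j v] that by simp
  qed
  have h_inj: "h v = h v' \<longleftrightarrow> v = v'" for v v'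
  proof
    assume "h v = h v'"
    moreover have "h v = h (v - v') + h v'" using h_add[of "v - v'" v'] by simp
    ultimately have "h (v - v') = 0" by simp
    thus "v = v'" using h_ker[of "v - v'"] by simp
  qed auto
  define v0 :: "'a ^ 'n" where "v0 = axis i0 1"
  have v0: "v0 \<noteq> 0" by (simp add: v0_def axis_eq_0_iff)
  hence hv0: "h v0 \<noteq> 0" using h_ker by blast
  have w_ord: "w ^ j = 1 \<longleftrightarrow> p ^ (r * CARD('n)) - 1 dvd j" for j
  proof -
    have "w ^ j = 1 \<longleftrightarrow> ((*v) c ^^ j) v0 = v0"
      using h_pow[of j v0] hv0 h_inj[of "((*v) c ^^ j) v0" v0] by simp
    also have "\<dots> \<longleftrightarrow> (\<forall>v. ((*v) c ^^ j) v = v)"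
    proof
      assume *: "((*v) c ^^ j) v0 = v0"
      show "\<forall>v. ((*v) c ^^ j) v = v"
      proof
        fix v show "((*v) c ^^ j) v = v"
        proof (cases "v = 0")
          case False
          then obtain i where i: "v = ((*v) c ^^ i) v0" using trans[OF v0] by metis
          have "((*v) c ^^ j) (((*v) c ^^ i) v0) = ((*v) c ^^ i) (((*v) c ^^ j) v0)"
            by (metis add.commute comp_apply funpow_add)
          thus ?thesis using * i by simp
        qed (simp add: funpow_linear)
      qed
    qed auto
    also have "\<dots> \<longleftrightarrow> p ^ (r * CARD('n)) - 1 dvd j"
      unfolding period by (simp add: p(2) power_mult)
    finally show ?thesis .
  qed
  interpret ff: finite_field_extension p r "CARD('n)" w
    by unfold_locales (use p w_ord in auto)
  define \<Phi> where "\<Phi> v = h v / h v0" for v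
  have \<Phi>_pow: "\<Phi> (((*v) c ^^ j) v0) = w ^ j" for j using hv0 by (simp add: \<Phi>_def h_pow)
  have "range \<Phi> = ff.K"
  proof (intro equalityI subsetI)
    fix x assume "x \<in> range \<Phi>"
    then obtain v where v: "x = \<Phi> v" by blast
    show "x \<in> ff.K"
    proof (cases "v = 0")
      case True
      thus ?thesis using v h0 by (simp add: \<Phi>_def)
    next
      case False
      then obtain j where "v = ((*v) c ^^ j) v0" using trans[OF v0] by metis
      thus ?thesis using v \<Phi>_pow ff.w_in_K by simp
    qed
  next
    fix x assume x: "x \<in> ff.K"
    show "x \<in> range \<Phi>"
    proof (cases "x = 0")
      case True
      thus ?thesis using h0 by (auto simp: \<Phi>_def intro!: range_eqI[of _ _ 0])
    next
      case False
      hence "x \<in> (\<lambda>k. w ^ k) ` {..<p ^ (r * CARD('n)) - 1}" using x ff.K_nonzero by blast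
      then obtain j where "x = w ^ j" by blast
      thus ?thesis using \<Phi>_pow[of j] by (metis rangeI)
    qed
  qed
  hence "singer_field_model p r CARD('n) w c \<Phi>"
    by unfold_locales (use p hv0 h_inj in \<open>auto simp: \<Phi>_def h_add h_scale h(3) add_divide_distrib\<close>)
  thus ?thesis by blast
qed

lemma to_ac_power_CARD: "(to_ac x :: 'a::{field,finite} alg_closure) ^ CARD('a) = to_ac x"
proof (cases "x = 0")
  case False
  have "(\<Prod>y\<in>UNIV-{0}. x * y) = (\<Prod>y\<in>UNIV-{0}. y)"
    by (rule prod.reindex_bij_witness[of _ "\<lambda>y. y / x" "\<lambda>y. x * y"]) (use False in auto)
  hence "x ^ (CARD('a) - 1) = 1" by (simp add: prod.distrib card_Diff_singleton)
  moreover have "CARD('a) = Suc (CARD('a) - 1)" using zero_less_card_finite[where 'a='a] by simp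
  ultimately have "x ^ CARD('a) = x" by (metis mult.right_neutral power_Suc)
  thus ?thesis by (metis to_ac_power)
qed (use zero_less_card_finite[where 'a='a] in simp)

section \<open>Generation of the general linear group by shears and determinants\<close>

text \<open>The identity matrix with \<open>v\<close> added to column \<open>k\<close>: a transvection if \<open>v $ k = 0\<close>, and the dilation with
factor \<open>d\<close> along a coordinate axis if \<open>v = axis k (d - 1)\<close>.\<close>

definition col_shear :: "'n::finite \<Rightarrow> 'a::field ^ 'n \<Rightarrow> 'a ^ 'n ^ 'n" where
  "col_shear k v = (\<chi> i j. (if i = j then 1 else 0) + (if j = k then v $ i else 0))"

lemma col_shear_apply: "col_shear k v *v u = u + (u $ k) *s v"
proof (subst vec_eq_iff, rule allI)
  fix i
  have "(col_shear k v *v u) $ i = (\<Sum>j\<in>UNIV. (if j = i then u $ j else 0) + (if j = k then u $ j * v $ i else 0))"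
    unfolding matrix_vector_mult_def col_shear_def vec_lambda_beta
    by (intro sum.cong refl) (simp add: distrib_right)
  thus "(col_shear k v *v u) $ i = (u + (u $ k) *s v) $ i"
    by (simp add: sum.distrib sum.delta)
qed

lemma det_col_shear: "det (col_shear k v) = 1 + v $ k"
proof -
  have "col_shear k v = (\<chi> i j. if j = k then (mat 1 *v (axis k 1 + v)) $ i else mat 1 $ i $ j)"
    unfolding matrix_vector_mul_lid by (simp add: vec_eq_iff col_shear_def mat_def axis_def)
  thus ?thesis using cramer_lemma[of k "mat 1" "axis k 1 + v"] by (simp add: axis_def)
qed

lemma matrix_axis_entry: "(M *v axis j 1) $ i = M $ i $ j" for M :: "'a::comm_semiring_1 ^ 'n ^ 'm"
proof -
  have "(M *v axis j 1) $ i = (\<Sum>l\<in>UNIV. if l = j then M $ i $ l else 0)"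
    unfolding matrix_vector_mult_def vec_lambda_beta by (intro sum.cong refl) (simp add: axis_def)
  thus ?thesis by (simp add: sum.delta)
qed

lemma matrix_eq_on_basis:
  fixes A B :: "'a::comm_semiring_1 ^ 'n ^ 'm"
  shows "(\<And>j. A *v axis j 1 = B *v axis j 1) \<Longrightarrow> A = B"
  by (metis matrix_axis_entry vec_eq_iff)

inductive_set shear_products :: "('a::field ^ 'n::finite ^ 'n) set" where
  one: "mat 1 \<in> shear_products"
| mult: "g \<in> shear_products \<Longrightarrow> v $ k = 0 \<Longrightarrow> col_shear k v ** g \<in> shear_products"

lemma det_shear_product: "g \<in> shear_products \<Longrightarrow> det g = 1"
  by (induction rule: shear_products.induct) (auto simp: det_mul det_col_shear)

text \<open>Gaussian elimination for one column \<open>v\<close>, without disturbing the coordinate vectors indexed by \<open>J\<close>. If a nonzero entry \<open>v $ l\<close> is found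
outside row \<open>j\<close>, one shear makes the entry in row \<open>j\<close> equal to one and another clears the rest.
Otherwise the only usable entry is \<open>v $ j\<close> itself, and the spare row \<open>k\<close> is filled from it first.\<close>

lemma shear_to_basis_vector:
  fixes v :: "'a::field ^ 'n"
  assumes g: "g \<in> shear_products" and J: "j \<notin> J" "k \<notin> insert j J" "l \<notin> J" "v $ l \<noteq> 0"
  shows "\<exists>h. h ** g \<in> shear_products \<and> h *v v = axis j 1 \<and> (\<forall>i\<in>J. h *v axis i 1 = axis i 1)"
proof -
  have direct: "\<exists>h. h ** g \<in> shear_products \<and> h *v v = axis j 1 \<and> (\<forall>i\<in>J. h *v axis i 1 = axis i 1)"
    if g: "g \<in> shear_products" and l: "l \<notin> insert j J" "v $ l \<noteq> 0"
    for g :: "'a ^ 'n ^ 'n" and v :: "'a ^ 'n" and l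
  proof -
    define h1 where "h1 = col_shear l (axis j ((1 - v $ j) / v $ l))"
    define w where "w = h1 *v v"
    define h2 where "h2 = col_shear j (axis j 1 - w)"
    have w: "w $ j = 1" using l by (simp add: w_def h1_def col_shear_apply axis_def)
    have "h1 ** g \<in> shear_products" unfolding h1_def using l g by (intro shear_products.mult) (auto simp: axis_def)
    hence "h2 ** (h1 ** g) \<in> shear_products" unfolding h2_def using w
      by (intro shear_products.mult) (auto simp: axis_def)
    moreover have "h2 *v (h1 *v v) = axis j 1" using w by (simp add: h2_def col_shear_apply flip: w_def)
    moreover have "h2 *v (h1 *v axis i 1) = axis i 1" if "i \<in> J" for i
    proof -
      have "i \<noteq> l" "i \<noteq> j" using that l J by auto
      thus ?thesis by (simp add: h1_def h2_def col_shear_apply axis_def)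
    qed
    ultimately show ?thesis
      by (intro exI[of _ "h2 ** h1"]) (auto simp: matrix_mul_assoc matrix_vector_mul_assoc)
  qed
  show ?thesis
  proof (cases "\<exists>l. l \<notin> insert j J \<and> v $ l \<noteq> 0")
    case True
    thus ?thesis using direct g by blast
  next
    case False
    hence vj: "v $ j \<noteq> 0" "v $ k = 0" using J by auto
    define h where "h = col_shear j (axis k (1::'a))"
    have hg: "h ** g \<in> shear_products" unfolding h_def using g J by (intro shear_products.mult) (auto simp: axis_def)
    have "(h *v v) $ k \<noteq> 0" using vj by (simp add: h_def col_shear_apply axis_def)
    then obtain h' where h': "h' ** (h ** g) \<in> shear_products" "h' *v (h *v v) = axis j 1"
      "\<forall>i\<in>J. h' *v axis i 1 = axis i 1"
      using direct[OF hg J(2)] by blast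
    moreover have "h *v axis i 1 = axis i 1" if "i \<in> J" for i
    proof -
      have "i \<noteq> j" using that J by auto
      thus ?thesis by (simp add: h_def col_shear_apply axis_def)
    qed
    ultimately show ?thesis
      by (intro exI[of _ "h' ** h"]) (auto simp: matrix_mul_assoc simp flip: matrix_vector_mul_assoc)
  qed
qed

text \<open>The columns other than \<open>k\<close> are reduced one at a time; \<open>k\<close> serves as the spare row throughout, which is why column \<open>k\<close>
comes last and keeps the determinant.\<close>

lemma shear_reduction_to_dilation:
  fixes A :: "'a::field ^ 'n ^ 'n"
  assumes A: "det A \<noteq> 0"
  shows "\<exists>g\<in>shear_products. g ** A = col_shear k (axis k (det A - 1))"
proof -
  have inj: "x = y" if "det M \<noteq> 0" "M *v x = M *v y" for M :: "'a ^ 'n ^ 'n" and x y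
    using that by (metis invertible_det_nz invertible_def matrix_vector_mul_assoc matrix_vector_mul_lid)
  have "\<exists>g\<in>shear_products. \<forall>j\<in>J. (g ** A) *v axis j 1 = axis j 1" if "finite J" "k \<notin> J" for J
    using that
  proof (induction J rule: finite_induct)
    case empty
    show ?case using shear_products.one by blast
  next
    case (insert j J)
    then obtain g where g: "g \<in> shear_products" "\<And>i. i \<in> J \<Longrightarrow> (g ** A) *v axis i 1 = axis i 1" by auto
    define M where "M = g ** A"
    have M: "det M \<noteq> 0" using A det_shear_product[OF g(1)] by (simp add: M_def det_mul)
    define v where "v = M *v axis j 1"
    have "\<exists>l. l \<notin> J \<and> v $ l \<noteq> 0"
    proof (rule ccontr)
      assume "\<not> ?thesis"
      hence vJ: "v $ l = 0" if "l \<notin> J" for l using that by blast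
      have "M *v (v) = v"
      proof -
        have vs: "v = (\<Sum>i\<in>J. v $ i *s axis i 1)"
        proof (subst vec_eq_iff, rule allI)
          fix l
          have "(\<Sum>i\<in>J. v $ i *s axis i (1::'a)) $ l = (\<Sum>i\<in>J. if i = l then v $ i else 0)"
            unfolding sum_component by (intro sum.cong refl) (simp add: axis_def)
          also have "\<dots> = v $ l" using vJ insert.hyps by (simp add: sum.delta')
          finally show "v $ l = (\<Sum>i\<in>J. v $ i *s axis i 1) $ l" by simp
        qed
        have "M *v (\<Sum>i\<in>J. v $ i *s axis i 1) = (\<Sum>i\<in>J. v $ i *s (M *v axis i 1))"
          by (simp add: vec.linear_sum[OF matrix_vector_mul_linear_gen] vector_scalar_commute)
        also have "\<dots> = (\<Sum>i\<in>J. v $ i *s axis i 1)"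
          using g(2) by (intro sum.cong) (auto simp: M_def)
        finally show ?thesis using vs by simp
      qed
      hence "v = axis j 1" using inj[OF M, of v "axis j 1"] by (simp flip: v_def)
      thus False using vJ[of j] insert.hyps by (simp add: axis_def)
    qed
    then obtain l where l: "l \<notin> J" "v $ l \<noteq> 0" by blast
    have "k \<notin> insert j J" using insert.prems by simp
    from shear_to_basis_vector[OF g(1) insert.hyps(2) this l] obtain h where
      h: "h ** g \<in> shear_products" "h *v v = axis j 1" "\<forall>i\<in>J. h *v axis i 1 = axis i 1" by blast
    have "(h ** g ** A) *v axis i 1 = axis i 1" if "i \<in> insert j J" for i
    proof -
      have "(h ** g ** A) *v axis i 1 = h *v (M *v axis i 1)"
        by (simp add: M_def matrix_vector_mul_assoc matrix_mul_assoc)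
      thus ?thesis using that g(2) h by (auto simp: v_def M_def)
    qed
    thus ?case using h(1) by blast
  qed
  from this[of "UNIV - {k}"] obtain g where
    g: "g \<in> shear_products" "\<And>j. j \<noteq> k \<Longrightarrow> (g ** A) *v axis j 1 = axis j 1" by auto
  define M where "M = g ** A"
  define w where "w = M *v axis k 1"
  define d where "d = w $ k"
  have M_shear: "M = col_shear k (w - axis k 1)"
  proof (rule matrix_eq_on_basis)
    fix j show "M *v axis j 1 = col_shear k (w - axis k 1) *v axis j 1"
      using g(2)[of j] by (cases "j = k") (auto simp: col_shear_apply M_def w_def, auto simp: axis_def)
  qed
  have "det M = d" unfolding M_shear det_col_shear by (simp add: d_def axis_def)
  hence d: "d = det A" "d \<noteq> 0" using A det_shear_product[OF g(1)] by (auto simp: M_def det_mul)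
  define h where "h = col_shear k (axis k 1 - (1 / d) *s w)"
  have hk: "(axis k 1 - (1 / d) *s w) $ k = 0" using d by (simp add: d_def axis_def)
  have "h ** g \<in> shear_products" unfolding h_def using g(1) hk by (rule shear_products.mult)
  moreover have "h ** g ** A = col_shear k (axis k (det A - 1))"
  proof (rule matrix_eq_on_basis)
    fix j
    have "h ** g ** A *v axis j 1 = h *v (M *v axis j 1)"
      by (simp add: M_def matrix_vector_mul_assoc matrix_mul_assoc)
    also have "\<dots> = col_shear k (axis k (det A - 1)) *v axis j 1"
    proof (cases "j = k")
      case True
      have "h *v w = w + d *s (axis k 1 - (1 / d) *s w)" by (simp add: h_def col_shear_apply d_def)
      also have "\<dots> = d *s axis k 1" using d by (simp add: vec.scale_right_diff_distrib)
      also have "\<dots> = col_shear k (axis k (det A - 1)) *v axis k 1"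
        using d(1) by (simp add: col_shear_apply vec_eq_iff axis_def)
      finally show ?thesis unfolding True w_def .
    next
      case False
      thus ?thesis using g(2)[OF False] by (simp add: M_def h_def col_shear_apply axis_def)
    qed
    finally show "h ** g ** A *v axis j 1 = col_shear k (axis k (det A - 1)) *v axis j 1" .
  qed
  ultimately show ?thesis by blast
qed

text \<open>Both \<open>A\<close> and an element \<open>B\<close> of \<open>S\<close> with the same determinant reduce by shears to the same dilation.\<close>

lemma shears_and_determinants_generate:
  fixes S :: "('a::field ^ 'n::finite ^ 'n) set"
  assumes mult: "\<And>A B. A \<in> S \<Longrightarrow> B \<in> S \<Longrightarrow> A ** B \<in> S"
    and inv: "\<And>A. A \<in> S \<Longrightarrow> \<exists>B\<in>S. B ** A = mat 1"
    and shear: "\<And>k v. v $ k = 0 \<Longrightarrow> col_shear k v \<in> S"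
    and dets: "\<And>d. d \<noteq> 0 \<Longrightarrow> \<exists>A\<in>S. det A = d"
    and A: "invertible A"
  shows "A \<in> S"
proof -
  fix k :: 'n
  have dA: "det A \<noteq> 0" using A by (simp add: invertible_det_nz)
  have "mat 1 = col_shear k (0 :: 'a ^ 'n)" by (simp add: vec_eq_iff mat_def col_shear_def)
  hence one: "mat 1 \<in> S" using shear[of 0 k] by simp
  have sub: "g \<in> S" if "g \<in> shear_products" for g
    using that by (induction rule: shear_products.induct) (auto intro: one mult shear)
  obtain B where B: "B \<in> S" "det B = det A" using dets[OF dA] by blast
  obtain g where g: "g \<in> shear_products" "g ** A = col_shear k (axis k (det A - 1))"
    using shear_reduction_to_dilation[OF dA] by blast
  obtain h where h: "h \<in> shear_products" "h ** B = col_shear k (axis k (det A - 1))"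
    using shear_reduction_to_dilation[of B k] dA B(2) by auto
  obtain g' where g': "g' \<in> S" "g' ** g = mat 1" using inv[OF sub[OF g(1)]] by blast
  have "A = g' ** g ** A" using g' by simp
  also have "\<dots> = g' ** (h ** B)" using g(2) h(2) by (simp add: matrix_mul_assoc[symmetric])
  finally show ?thesis using g'(1) sub[OF h(1)] B(1) mult by simp
qed

section \<open>Functionals as trace forms and the norm of a Singer cycle\<close>

context singer_field_model
begin

lemma \<Phi>_K [simp]: "\<Phi> v \<in> K" using \<Phi>_range by blast

lemma \<Phi>_surj: "x \<in> K \<Longrightarrow> \<exists>v. \<Phi> v = x" unfolding \<Phi>_range[symmetric] by auto

lemma \<Phi>_0 [simp]: "\<Phi> 0 = 0" using \<Phi>_scale[of 0 0] by simp

lemma \<Phi>_eq_0_iff: "\<Phi> v = 0 \<longleftrightarrow> v = 0" using \<Phi>_inj[of v 0] by simp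

lemma frob_to_ac [simp]: "frob (r * i) (to_ac x) = to_ac x"
  using to_ac_power_CARD[of x] q by (intro frob_fixed) (simp add: frob_def)

lemma frob_to_ac' [simp]: "frob r (to_ac x) = to_ac x"
  using frob_to_ac[of 1 x] by simp

lemma fixed_in_range_to_ac:
  assumes "frob r x = x"
  shows "x \<in> range to_ac"
proof -
  define P :: "'a alg_closure poly" where "P = monom 1 (p ^ r) - monom 1 1"
  have P: "poly P x = frob r x - x" for x by (simp add: P_def poly_monom frob_def)
  have "p ^ r > p ^ 0" using p_ge_2 r by (intro power_strict_increasing) auto
  hence "coeff P (p ^ r) = 1" by (simp add: P_def)
  hence "P \<noteq> 0" by auto
  have "degree P \<le> p ^ r" unfolding P_def using \<open>p ^ r > p ^ 0\<close>
    by (intro degree_diff_le) (auto intro!: order_trans[OF degree_monom_le])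
  hence "card {x. poly P x = 0} \<le> p ^ r" using card_poly_roots_bound[OF \<open>P \<noteq> 0\<close>] by linarith
  moreover have "card (range (to_ac :: 'a \<Rightarrow> _)) = p ^ r" using q by (simp add: card_image inj_to_ac)
  moreover have "range to_ac \<subseteq> {x. poly P x = 0}" by (auto simp: P)
  ultimately have "range to_ac = {x. poly P x = 0}"
    by (intro card_seteq) (auto intro!: poly_roots_finite \<open>P \<noteq> 0\<close>)
  thus ?thesis using assms by (auto simp: P)
qed

lemma additive_expansion:
  fixes f :: "'a ^ 'n \<Rightarrow> 'b::comm_ring_1"
  assumes "\<And>v w. f (v + w) = f v + f w" "\<And>k v. f (k *s v) = g k * f v" "g 0 = 0"
  shows "f v = (\<Sum>j\<in>UNIV. g (v $ j) * f (axis j 1))"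
proof -
  have f0: "f 0 = 0" using assms(2)[of 0 0] assms(3) by simp
  have "f (sum u A) = (\<Sum>x\<in>A. f (u x))" for u :: "'n \<Rightarrow> 'a ^ 'n" and A
    by (induction A rule: infinite_finite_induct) (auto simp: f0 assms(1))
  from this[of "\<lambda>i. (v $ i) *s axis i 1" UNIV] show ?thesis
    by (simp add: basis_expansion assms(2))
qed

text \<open>The map from \<open>b\<close> to the functional \<open>Tr (b * x)\<close> is injective since the trace is not zero, and there are as
many elements of \<open>K\<close> as linear functionals.\<close>

theorem functional_is_trace_form:
  fixes f :: "'a ^ 'n \<Rightarrow> 'a"
  assumes add: "\<And>v w. f (v + w) = f v + f w" and scale: "\<And>k v. f (k *s v) = k * f v"
  shows "\<exists>b\<in>K. \<forall>v. to_ac (f v) = Tr (b * \<Phi> v)"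
proof -
  define \<Psi> :: "'a alg_closure \<Rightarrow> 'a ^ 'n" where "\<Psi> b = (\<chi> j. of_ac (Tr (b * \<Phi> (axis j 1))))" for b
  have \<Psi>: "to_ac (\<Psi> b $ j) = Tr (b * \<Phi> (axis j 1))" if "b \<in> K" for b j
    unfolding \<Psi>_def using that by (simp add: to_ac_of_ac fixed_in_range_to_ac frob_Tr)
  have Tr_scale: "Tr (b * \<Phi> (k *s v)) = to_ac k * Tr (b * \<Phi> v)" for b k v
    using Tr_smult[of "to_ac k" "b * \<Phi> v"] by (simp add: \<Phi>_scale mult_ac)
  have exp: "Tr (b * \<Phi> v) = (\<Sum>j\<in>UNIV. to_ac (v $ j) * Tr (b * \<Phi> (axis j 1)))" for b v
    by (rule additive_expansion) (simp_all add: \<Phi>_add Tr_scale distrib_left)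
  have "inj_on \<Psi> K"
  proof (rule inj_onI)
    fix b b' assume b: "b \<in> K" "b' \<in> K" "\<Psi> b = \<Psi> b'"
    have zero: "Tr ((b - b') * x) = 0" if x: "x \<in> K" for x
    proof -
      obtain v where "\<Phi> v = x" using \<Phi>_surj[OF x] by blast
      moreover have "Tr (b * \<Phi> v) = Tr (b' * \<Phi> v)"
        unfolding exp[of b v] exp[of b' v] using \<Psi>[OF b(1)] \<Psi>[OF b(2)] b(3) by simp
      ultimately show ?thesis by (simp add: left_diff_distrib)
    qed
    obtain y where y: "y \<in> K" "Tr y \<noteq> 0" using Tr_nonzero_exists by blast
    have "y / (b - b') \<in> K" using K_closed(6)[OF y(1) K_closed(4)[OF b(1,2)]] .
    hence "Tr ((b - b') * (y / (b - b'))) = 0" by (rule zero)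
    thus "b = b'" using y(2) by (cases "b = b'") simp_all
  qed
  hence "card (\<Psi> ` K) = CARD('a ^ 'n)"
    using q by (simp only: card_image card_K CARD_vec n_def[symmetric] power_mult)
  hence "\<Psi> ` K = UNIV" by (intro card_subset_eq) (auto)
  then obtain b where b: "b \<in> K" "\<Psi> b = (\<chi> j. f (axis j 1))" by (metis UNIV_I imageE)
  have "to_ac (f v) = Tr (b * \<Phi> v)" for v
  proof -
    have "f v = (\<Sum>j\<in>UNIV. v $ j * f (axis j 1))"
      by (rule additive_expansion) (simp_all add: add scale)
    hence "to_ac (f v) = (\<Sum>j\<in>UNIV. to_ac (v $ j) * to_ac (\<Psi> b $ j))"
      by (simp add: b(2) to_ac_sum)
    also have "\<dots> = Tr (b * \<Phi> v)" unfolding exp[of b v] \<Psi>[OF b(1)] ..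
    finally show ?thesis .
  qed
  thus ?thesis using b(1) by blast
qed

text \<open>The matrix \<open>P\<close> of all Frobenius conjugates of the images of a basis (the Moore matrix) diagonalizes \<open>c\<close> over the
algebraic closure, with the conjugates of \<open>w\<close> as eigenvalues. It is invertible because a linear
relation between its rows would be a polynomial of degree at most \<open>p ^ (r * n - 1)\<close> that vanishes on all of \<open>K\<close>.\<close>

lemma w_power_norm: "to_ac (det c) = w ^ (\<Sum>i<n. p ^ (r * i))"
proof -
  obtain e :: "'n \<Rightarrow> nat" where e: "bij_betw e UNIV {..<n}"
    using ex_bij_betw_finite_nat[of "UNIV :: 'n set"] by (auto simp: n_def atLeast0LessThan)
  have e_lt: "e i < n" for i using e by (auto simp: bij_betw_def)
  have e_inj: "e i = e j \<longleftrightarrow> i = j" for i j using e by (auto simp: bij_betw_def inj_on_def)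
  define P :: "'a alg_closure ^ 'n ^ 'n" where "P = (\<chi> i j. frob (r * e i) (\<Phi> (axis j 1)))"
  define C :: "'a alg_closure ^ 'n ^ 'n" where "C = (\<chi> i j. to_ac (c $ i $ j))"
  define W :: "'a alg_closure ^ 'n ^ 'n" where "W = (\<chi> i j. if i = j then frob (r * e i) w else 0)"
  have exp: "frob (r * i) (\<Phi> v) = (\<Sum>j\<in>UNIV. to_ac (v $ j) * frob (r * i) (\<Phi> (axis j 1)))" for i v
    by (rule additive_expansion) (simp_all add: \<Phi>_add \<Phi>_scale)
  have "P ** C = W ** P"
  proof -
    have "(P ** C) $ i $ k = (W ** P) $ i $ k" for i k
    proof -
      have "(P ** C) $ i $ k = (\<Sum>j\<in>UNIV. to_ac ((c *v axis k 1) $ j) * frob (r * e i) (\<Phi> (axis j 1)))"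
        unfolding matrix_matrix_mult_def P_def C_def
        by (simp add: matrix_axis_entry mult.commute)
      also have "\<dots> = frob (r * e i) (\<Phi> (c *v axis k 1))" by (rule exp[symmetric])
      also have "\<dots> = frob (r * e i) w * P $ i $ k" by (simp add: \<Phi>_c P_def)
      also have "\<dots> = (\<Sum>j\<in>UNIV. if j = i then frob (r * e i) w * P $ i $ k else 0)" by simp
      also have "\<dots> = (W ** P) $ i $ k"
        unfolding matrix_matrix_mult_def W_def vec_lambda_beta by (intro sum.cong refl) auto
      finally show ?thesis .
    qed
    thus ?thesis by (simp add: vec_eq_iff)
  qed
  hence "det P * det C = det W * det P" by (metis det_mul)
  moreover have "det P \<noteq> 0"
  proof
    assume "det P = 0"
    hence "\<not> invertible (transpose P)" by (simp add: invertible_det_nz)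
    then obtain x where x: "transpose P *v x = 0" "x \<noteq> 0"
      using matrix_left_invertible_ker[of "transpose P"] invertible_left_inverse[of "transpose P"] by auto
    \<comment> \<open>The entries of \<open>x\<close> are the coefficients of a relation between the rows of \<open>P\<close>.\<close>
    define Q where "Q = (\<Sum>i\<in>UNIV. monom (x $ i) (p ^ (r * e i)))"
    have Q0: "poly Q (\<Phi> v) = 0" for v
    proof -
      have "poly Q (\<Phi> v) = (\<Sum>i\<in>UNIV. x $ i * frob (r * e i) (\<Phi> v))"
        by (simp add: Q_def poly_sum poly_monom frob_def)
      also have "\<dots> = (\<Sum>i\<in>UNIV. \<Sum>j\<in>UNIV. to_ac (v $ j) * (P $ i $ j * x $ i))"
        by (subst exp) (simp add: P_def sum_distrib_left mult_ac)
      also have "\<dots> = (\<Sum>j\<in>UNIV. to_ac (v $ j) * (transpose P *v x) $ j)"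
        by (subst sum.swap) (simp add: matrix_vector_mult_def transpose_def sum_distrib_left del: transpose_matrix_vector)
      also have "\<dots> = 0" unfolding x(1) by simp
      finally show ?thesis .
    qed
    obtain i where i: "x $ i \<noteq> 0" using x(2) by (auto simp: vec_eq_iff)
    have "coeff Q (p ^ (r * e i)) = (\<Sum>j\<in>UNIV. if j = i then x $ j else 0)"
      unfolding Q_def coeff_sum using p_ge_2 r e_inj by (intro sum.cong refl) auto
    hence "Q \<noteq> 0" using i by auto
    have "degree Q \<le> p ^ (r * n - 1)" unfolding Q_def
    proof (rule degree_sum_le)
      fix j
      have "r * e j < r * n" using r e_lt by simp
      hence "r * e j \<le> r * n - 1" by linarith
      hence "p ^ (r * e j) \<le> p ^ (r * n - 1)" using p_ge_2 by (intro power_increasing) auto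
      thus "degree (monom (x $ j) (p ^ (r * e j))) \<le> p ^ (r * n - 1)"
        by (rule order_trans[OF degree_monom_le])
    qed auto
    moreover have "K \<subseteq> {y. poly Q y = 0}" unfolding \<Phi>_range[symmetric] using Q0 by auto
    ultimately have "card K \<le> p ^ (r * n - 1)"
      using card_mono[OF poly_roots_finite[OF \<open>Q \<noteq> 0\<close>], of K] card_poly_roots_bound[OF \<open>Q \<noteq> 0\<close>] by auto
    moreover have "p ^ (r * n - 1) < p ^ (r * n)"
      using rn p_ge_2 by (intro power_strict_increasing) auto
    ultimately show False using card_K by linarith
  qed
  ultimately have "det C = det W" by simp
  moreover have "det C = to_ac (det c)"
    by (simp add: det_def C_def to_ac_sum to_ac_prod)
  moreover have "det W = (\<Prod>i\<in>UNIV. frob (r * e i) w)"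
    by (subst det_diagonal) (auto simp: W_def)
  moreover have "(\<Prod>i\<in>UNIV. frob (r * e i) w) = (\<Prod>i<n. frob (r * i) w)"
    by (rule prod.reindex_bij_betw[OF e])
  ultimately show ?thesis by (simp add: frob_def power_sum)
qed

text \<open>With \<open>q = p ^ r\<close>, the determinant is \<open>w\<close> to the power \<open>(q ^ n - 1) / (q - 1)\<close>, so it has order \<open>q - 1\<close>.\<close>

lemma det_power_surj:
  assumes "d \<noteq> 0"
  shows "\<exists>j. det c ^ j = d"
proof -
  define S where "S = (\<Sum>i<n. p ^ (r * i))"
  define m where "m = p ^ r - 1"
  have "p ^ r > p ^ 0" using p_ge_2 r by (intro power_strict_increasing) auto
  hence m: "m > 0" "CARD('a) = Suc m" using q by (auto simp: m_def)
  have "(p ^ r - 1) * S = p ^ (r * n) - 1"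
  proof -
    have "S = (\<Sum>i<n. (p ^ r) ^ i)" by (simp add: S_def power_mult)
    hence "int ((p ^ r - 1) * S) = int (p ^ (r * n) - 1)"
      using power_diff_1_eq[of "int (p ^ r)" n] p_ge_2 by (simp add: of_nat_diff power_mult)
    thus ?thesis by (simp only: of_nat_eq_iff)
  qed
  hence mS: "m * S = p ^ (r * n) - 1" by (simp add: m_def)
  have "S > 0" using mS pM by (intro Nat.gr0I) auto
  have detc: "to_ac (det c) = w ^ S" unfolding S_def by (rule w_power_norm)
  hence "det c \<noteq> 0" using w_nonzero by (metis power_not_zero to_ac_eq_0_iff)
  have "inj_on (\<lambda>j. det c ^ j) {..<m}"
  proof (rule linorder_inj_onI')
    fix i j assume ij: "i \<in> {..<m}" "j \<in> {..<m}" "i < j"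
    show "det c ^ i \<noteq> det c ^ j"
    proof
      assume "det c ^ i = det c ^ j"
      hence "det c ^ (j - i) = 1" using ij \<open>det c \<noteq> 0\<close> by (simp add: power_diff)
      hence "w ^ (S * (j - i)) = 1" using detc by (metis power_mult to_ac_1 to_ac_power)
      hence "m * S dvd S * (j - i)" using w mS by simp
      hence "m dvd j - i" using \<open>S > 0\<close> by (simp add: mult.commute[of m])
      thus False using ij by (auto dest: dvd_imp_le)
    qed
  qed
  hence "card ((\<lambda>j. det c ^ j) ` {..<m}) = m" by (simp add: card_image)
  moreover have "card (UNIV - {0::'a}) = m" using m by (simp add: card_Diff_singleton)
  ultimately have "(\<lambda>j. det c ^ j) ` {..<m} = UNIV - {0}"
    using \<open>det c \<noteq> 0\<close> by (intro card_subset_eq) auto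
  moreover have "d \<in> UNIV - {0}" using assms by simp
  ultimately obtain j where "d = det c ^ j" by blast
  thus ?thesis by blast
qed

end

section \<open>Subgroups containing a Singer cycle and a reflection\<close>

text \<open>Pick \<open>z\<close> outside the hyperplane; every vector is congruent to a unique multiple \<open>f v\<close> of \<open>z\<close> modulo the hyperplane.\<close>

lemma rank_one_of_fixed_hyperplane:
  fixes t :: "'a::field ^ 'n ^ 'n"
  assumes H: "vec.subspace H" "vec.dim H = CARD('n) - 1" "\<And>v. v \<in> H \<Longrightarrow> t *v v = v" and t: "t \<noteq> mat 1"
  obtains f w where "\<And>v w. f (v + w) = f v + f w" "\<And>k v. f (k *s v) = k * f v"
    "\<And>v. t *v v = v + f v *s w" "w \<noteq> 0"
proof -
  have "H \<noteq> UNIV"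
  proof
    assume "H = UNIV"
    hence "t *v v = mat 1 *v v" for v using H(3) by simp
    thus False using t matrix_eq by blast
  qed
  then obtain z where z: "z \<notin> H" by blast
  obtain B where B: "B \<subseteq> H" "vec.independent B" "H \<subseteq> vec.span B" "card B = vec.dim H"
    using vec.basis_exists by blast
  have span: "vec.span B = H" using B(1,3) H(1) vec.span_subspace by blast
  have "finite B" using B(2) vec.finiteI_independent by blast
  have "vec.independent (insert z B)" using B(2) z span by (simp add: vec.independent_insert)
  moreover have "card (insert z B) = CARD('n)"
  proof -
    have "z \<notin> B" using z B(1) by blast
    thus ?thesis using \<open>finite B\<close> B(4) H(2) by simp
  qed
  ultimately have "vec.span (insert z B) = UNIV"
    using vec.card_eq_dim[of "insert z B" UNIV] \<open>finite B\<close> vec_dim_card[where 'a='a and 'n='n] by auto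
  hence ex: "\<exists>k. v - k *s z \<in> H" for v
    using vec.span_breakdown_eq[of v z B] span by blast
  have uniq: "k = l" if "v - k *s z \<in> H" "v - l *s z \<in> H" for k l v
  proof (rule ccontr)
    assume "k \<noteq> l"
    have "(v - k *s z) - (v - l *s z) \<in> H" using that by (rule vec.subspace_diff[OF H(1)])
    hence "(l - k) *s z \<in> H" by (simp add: vec.scale_left_diff_distrib)
    hence "inverse (l - k) *s ((l - k) *s z) \<in> H" by (rule vec.subspace_scale[OF H(1)])
    also have "inverse (l - k) *s ((l - k) *s z) = z"
      unfolding vec.scale_scale using \<open>k \<noteq> l\<close> by simp
    finally show False using z by blast
  qed
  define f where "f v = (THE k. v - k *s z \<in> H)" for v
  have f: "v - f v *s z \<in> H" for v
    unfolding f_def by (rule theI') (use ex uniq in blast)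
  have f_eq: "f v = k" if "v - k *s z \<in> H" for v k using uniq[OF f that] .
  define u where "u = t *v z - z"
  show ?thesis
  proof (rule that)
    fix v v' show "f (v + v') = f v + f v'"
    proof (rule f_eq)
      have "(v + v') - (f v + f v') *s z = (v - f v *s z) + (v' - f v' *s z)"
        by (simp add: vec.scale_left_distrib)
      thus "(v + v') - (f v + f v') *s z \<in> H" using vec.subspace_add[OF H(1) f[of v] f[of v']] by (simp only:)
    qed
  next
    fix k v show "f (k *s v) = k * f v"
    proof (rule f_eq)
      have "k *s v - (k * f v) *s z = k *s (v - f v *s z)"
        by (simp add: vec.scale_right_diff_distrib)
      thus "k *s v - (k * f v) *s z \<in> H" using vec.subspace_scale[OF H(1) f[of v], of k] by (simp only:)
    qed
  next
    fix v
    have "t *v v = t *v ((v - f v *s z) + f v *s z)" by simp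
    also have "\<dots> = (v - f v *s z) + f v *s (t *v z)"
      unfolding matrix_vector_right_distrib vector_scalar_commute H(3)[OF f] ..
    finally show eq: "t *v v = v + f v *s u" by (simp add: u_def vec.scale_right_diff_distrib)
  next
    show "u \<noteq> 0"
    proof
      assume "u = 0"
      have "t *v v = mat 1 *v v" for v
      proof -
        have "t *v v = t *v ((v - f v *s z) + f v *s z)" by simp
        also have "\<dots> = (v - f v *s z) + f v *s (t *v z)"
          unfolding matrix_vector_right_distrib vector_scalar_commute H(3)[OF f] ..
        finally show ?thesis using \<open>u = 0\<close> by (simp add: u_def)
      qed
      thus False using t matrix_eq by blast
    qed
  qed
qed

text \<open>The hypothesis says \<open>t c t\<^sup>-\<^sup>1 = c\<^sup>m\<close>, so conjugation by \<open>t\<close> maps the cyclic group into itself; as the group is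
finite, onto itself.\<close>

lemma conjugate_power_normalizes:
  fixes c t :: "'a::{field,finite} ^ 'n ^ 'n"
  assumes c: "c \<in> carrier GL" and t: "t \<in> carrier GL"
    and eq: "\<And>v. t *v (c *v v) = ((*v) c ^^ m) (t *v v)"
  shows "t \<in> normalizer GL (generate GL {c})"
proof -
  interpret GL: group "GL :: ('a ^ 'n ^ 'n) monoid" by (rule group_GL)
  define H where "H = generate GL {c}"
  have HC: "H \<subseteq> carrier GL" unfolding H_def using c by (intro GL.generate_incl) auto
  have sub: "subgroup H GL" unfolding H_def using c by (intro GL.generate_is_subgroup) auto
  have "(t ** c) *v v = ((c [^]\<^bsub>GL\<^esub> m) ** t) *v v" for v
    using eq[of v] by (simp add: GL_pow_apply flip: matrix_vector_mul_assoc)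
  hence "t ** c = (c [^]\<^bsub>GL\<^esub> m) ** t" using matrix_eq by blast
  hence tc: "t \<otimes>\<^bsub>GL\<^esub> c = (c [^]\<^bsub>GL\<^esub> m) \<otimes>\<^bsub>GL\<^esub> t" by (simp add: GL_def)
  have "c \<in> H" unfolding H_def by (rule generate.incl) simp
  hence cm: "c [^]\<^bsub>GL\<^esub> m \<in> H" by (induction m) (auto intro: subgroup.m_closed[OF sub] subgroup.one_closed[OF sub])
  have conj_c: "t \<otimes>\<^bsub>GL\<^esub> c \<otimes>\<^bsub>GL\<^esub> inv\<^bsub>GL\<^esub> t = c [^]\<^bsub>GL\<^esub> m"
    using c t by (simp add: tc GL.m_assoc)
  have conj_H: "t \<otimes>\<^bsub>GL\<^esub> h \<otimes>\<^bsub>GL\<^esub> inv\<^bsub>GL\<^esub> t \<in> H" if "h \<in> H" for h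
    using that unfolding H_def
  proof (induction rule: generate.induct)
    case one
    show ?case using t by (simp add: generate.one)
  next
    case (incl h)
    thus ?case using cm conj_c by (simp add: H_def)
  next
    case (inv h)
    have "t \<otimes>\<^bsub>GL\<^esub> inv\<^bsub>GL\<^esub> c \<otimes>\<^bsub>GL\<^esub> inv\<^bsub>GL\<^esub> t = inv\<^bsub>GL\<^esub> (c [^]\<^bsub>GL\<^esub> m)"
      unfolding conj_c[symmetric] using c t by (simp add: GL.inv_mult_group GL.m_assoc)
    thus ?case using subgroup.m_inv_closed[OF sub cm] inv by (simp add: H_def)
  next
    case (eng h h')
    have hC: "h \<in> carrier GL" "h' \<in> carrier GL" using eng HC by (auto simp: H_def)
    have "t \<otimes>\<^bsub>GL\<^esub> (h \<otimes>\<^bsub>GL\<^esub> h') \<otimes>\<^bsub>GL\<^esub> inv\<^bsub>GL\<^esub> t =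
      (t \<otimes>\<^bsub>GL\<^esub> h \<otimes>\<^bsub>GL\<^esub> inv\<^bsub>GL\<^esub> t) \<otimes>\<^bsub>GL\<^esub> (t \<otimes>\<^bsub>GL\<^esub> h' \<otimes>\<^bsub>GL\<^esub> inv\<^bsub>GL\<^esub> t)"
    proof -
      have "inv\<^bsub>GL\<^esub> t \<otimes>\<^bsub>GL\<^esub> (t \<otimes>\<^bsub>GL\<^esub> x) = x" if "x \<in> carrier GL" for x
        using that t by (simp flip: GL.m_assoc)
      thus ?thesis using hC t by (simp add: GL.m_assoc)
    qed
    thus ?case using generate.eng[OF eng(3,4)] by simp
  qed
  define g where "g h = t \<otimes>\<^bsub>GL\<^esub> h \<otimes>\<^bsub>GL\<^esub> inv\<^bsub>GL\<^esub> t" for h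
  have "t <#\<^bsub>GL\<^esub> H #>\<^bsub>GL\<^esub> inv\<^bsub>GL\<^esub> t = g ` H"
    by (auto simp: l_coset_def r_coset_def g_def)
  also have "\<dots> = H"
  proof (rule card_subset_eq)
    show "finite H" by (rule finite_subset[OF subset_UNIV]) simp
    show "g ` H \<subseteq> H" using conj_H by (auto simp: g_def)
    have "inj_on g H"
    proof (rule inj_onI)
      fix x y assume xy: "x \<in> H" "y \<in> H" "g x = g y"
      have xc: "x \<in> carrier GL" "y \<in> carrier GL" using xy HC by auto
      hence "t \<otimes>\<^bsub>GL\<^esub> x = t \<otimes>\<^bsub>GL\<^esub> y"
        using xy(3) t by (simp add: g_def GL.right_cancel)
      thus "x = y" using xc t by simp
    qed
    thus "card (g ` H) = card H" by (rule card_image)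
  qed
  finally show ?thesis
    using t HC by (simp add: normalizer_def stabilizer_def H_def)
qed

context singer_field_model
begin

definition induced_maps :: "('a ^ 'n ^ 'n) set \<Rightarrow> ('a alg_closure \<Rightarrow> 'a alg_closure) set" where
  "induced_maps S = {f. \<exists>A\<in>S. \<forall>v. \<Phi> (A *v v) = f (\<Phi> v)}"

lemma \<Phi>_funpow: "\<Phi> (((*v) c ^^ j) v) = w ^ j * \<Phi> v"
  by (induction j) (auto simp: \<Phi>_c)

lemma linear_action_induced_maps:
  assumes S: "subgroup S GL" and cS: "c \<in> S"
  shows "linear_action p r n w (induced_maps S)"
proof -
  interpret GL: group "GL :: ('a ^ 'n ^ 'n) monoid" by (rule group_GL)
  have SC: "A \<in> carrier GL" if "A \<in> S" for A using subgroup.subset[OF S] that by blast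
  have mult: "A ** B \<in> S" if "A \<in> S" "B \<in> S" for A B
    using subgroup.m_closed[OF S that] by (simp add: GL_def)
  have inverse: "\<exists>B\<in>S. A ** B = mat 1 \<and> B ** A = mat 1" if A: "A \<in> S" for A
    using GL.r_inv[OF SC[OF A]] GL.l_inv[OF SC[OF A]] subgroup.m_inv_closed[OF S A]
    by (intro bexI[of _ "inv\<^bsub>GL\<^esub> A"]) (simp_all add: GL_def)
  show ?thesis
  proof unfold_locales
    fix f g assume "f \<in> induced_maps S" "g \<in> induced_maps S"
    then obtain A B where "A \<in> S" "B \<in> S" "\<And>v. \<Phi> (A *v v) = f (\<Phi> v)" "\<And>v. \<Phi> (B *v v) = g (\<Phi> v)"
      by (auto simp: induced_maps_def)
    thus "(\<lambda>x. f (g x)) \<in> induced_maps S"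
      using mult by (auto simp: induced_maps_def simp flip: matrix_vector_mul_assoc intro!: bexI[of _ "A ** B"])
  next
    fix a assume a: "a \<in> K" "a \<noteq> 0"
    then obtain j where j: "a = w ^ j" using K_nonzero by blast
    have "c [^]\<^bsub>GL\<^esub> j \<in> S"
      using cS by (induction j) (auto intro: subgroup.m_closed[OF S] subgroup.one_closed[OF S])
    thus "(\<lambda>x. a * x) \<in> induced_maps S"
      by (auto simp: induced_maps_def GL_pow_apply \<Phi>_funpow j intro!: bexI[of _ "c [^]\<^bsub>GL\<^esub> j"])
  next
    fix f g assume f: "f \<in> induced_maps S" and g: "\<And>x. x \<in> K \<Longrightarrow> g (f x) = x"
    obtain A where A: "A \<in> S" "\<And>v. \<Phi> (A *v v) = f (\<Phi> v)" using f by (auto simp: induced_maps_def)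
    obtain B where B: "B \<in> S" "A ** B = mat 1" using inverse[OF A(1)] by blast
    have "\<Phi> (B *v v) = g (\<Phi> v)" for v
    proof -
      have "g (\<Phi> v) = g (\<Phi> (A *v (B *v v)))" by (simp add: matrix_vector_mul_assoc B(2))
      also have "\<dots> = \<Phi> (B *v v)" by (simp add: A(2) g)
      finally show ?thesis by simp
    qed
    thus "g \<in> induced_maps S" using B(1) by (auto simp: induced_maps_def)
  next
    fix f g assume f: "f \<in> induced_maps S" and g: "\<And>x. x \<in> K \<Longrightarrow> f x = g x"
    thus "g \<in> induced_maps S" by (auto simp: induced_maps_def)
  next
    fix f assume f: "f \<in> induced_maps S"
    obtain A where A: "A \<in> S" "\<And>v. \<Phi> (A *v v) = f (\<Phi> v)" using f by (auto simp: induced_maps_def)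
    obtain B where B: "B ** A = mat 1" using inverse[OF A(1)] by blast
    show "inj_on f K"
    proof (rule inj_onI)
      fix x y assume "x \<in> K" "y \<in> K" and eq: "f x = f y"
      then obtain u v where uv: "x = \<Phi> u" "y = \<Phi> v" using \<Phi>_surj by metis
      hence "A *v u = A *v v" using eq A(2) \<Phi>_inj by metis
      hence "B *v (A *v u) = B *v (A *v v)" by simp
      thus "x = y" using uv by (simp add: matrix_vector_mul_assoc B)
    qed
  qed
qed

text \<open>The image of \<open>t\<close> under the identification with \<open>K\<close> is conjugate, by a multiplication, to a reflection with axis the kernel of the
trace, to which \<open>trace_zero_in_D0\<close> applies. Conversely every shear is conjugate by a multiplication to a transvection
with that axis.\<close>

theorem subgroup_with_reflection_is_everything:
  assumes S: "subgroup S GL" and cS: "c \<in> S" and tS: "t \<in> S" and t: "reflection t"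
    and not_norm: "\<not> (n = 2 \<and> t \<in> normalizer GL (generate GL {c}))"
  shows "S = carrier GL"
proof -
  interpret GL: group "GL :: ('a ^ 'n ^ 'n) monoid" by (rule group_GL)
  interpret linear_action p r n w "induced_maps S" by (rule linear_action_induced_maps[OF S cS])
  have SC: "S \<subseteq> carrier GL" using subgroup.subset[OF S] .
  obtain H where H: "vec.subspace H" "vec.dim H = CARD('n) - 1" "\<And>v. v \<in> H \<Longrightarrow> t *v v = v"
    and t1: "t \<noteq> mat 1" and tC: "t \<in> carrier GL"
    using t unfolding reflection_def by blast
  obtain f u where f_add: "\<And>v w. f (v + w) = f v + f w" and f_scale: "\<And>k v. f (k *s v) = k * f v"
    and tf: "\<And>v. t *v v = v + f v *s u" and u: "u \<noteq> 0"
    by (rule rank_one_of_fixed_hyperplane[OF H t1]) auto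
  obtain b where b: "b \<in> K" "\<And>v. to_ac (f v) = Tr (b * \<Phi> v)"
    using functional_is_trace_form[of f, OF f_add f_scale] by blast
  have "b \<noteq> 0"
  proof
    assume "b = 0"
    hence "f v = 0" for v using b(2)[of v] by simp
    hence "t *v v = mat 1 *v v" for v by (simp add: tf)
    thus False using t1 matrix_eq by blast
  qed
  define a where "a = b * \<Phi> u"
  have a: "a \<in> K" "a \<noteq> 0" using b(1) \<open>b \<noteq> 0\<close> u by (auto simp: a_def \<Phi>_eq_0_iff)
  have t_map: "\<Phi> (t *v v) = \<Phi> v + \<Phi> u * Tr (b * \<Phi> v)" for v
    by (simp add: tf \<Phi>_add \<Phi>_scale b(2) mult.commute)
  hence t_F: "(\<lambda>x. x + \<Phi> u * Tr (b * x)) \<in> induced_maps S"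
    using tS by (auto simp: induced_maps_def)
  have "(\<lambda>x. b * (inverse b * x + \<Phi> u * Tr (b * (inverse b * x)))) \<in> induced_maps S"
    using comp[OF scale[OF b(1) \<open>b \<noteq> 0\<close>] comp[OF t_F scale[of "inverse b"]]] b(1) \<open>b \<noteq> 0\<close> by auto
  hence "(\<lambda>x. x + a * Tr x) \<in> induced_maps S"
    by (rule cong) (use \<open>b \<noteq> 0\<close> in \<open>simp add: a_def distrib_left mult.assoc[symmetric]\<close>)
  hence aD: "a \<in> D" using a by (simp add: D_def)
  have not_special: "\<not> (n = 2 \<and> a = -1)"
  proof
    assume *: "n = 2 \<and> a = -1"
    have TrK: "Tr x = x + frob r x" for x
      unfolding Tr_def using * by (simp add: numeral_2_eq_2)
    \<comment> \<open>In the exceptional case \<open>t\<close> acts as \<open>x \<mapsto> k * frob r x\<close>, so it conjugates multiplication by \<open>w\<close> to multiplication by \<open>w ^ q\<close>.\<close>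
    define k where "k = \<Phi> u * frob r b"
    have tk: "\<Phi> (t *v v) = k * frob r (\<Phi> v)" for v
    proof -
      have "\<Phi> u * b = - 1" using * by (simp add: a_def mult.commute)
      hence "\<Phi> u * (b * \<Phi> v) = - \<Phi> v" by (simp add: mult.assoc[symmetric])
      thus ?thesis unfolding t_map TrK by (simp add: k_def distrib_left mult.assoc)
    qed
    have "t *v (c *v v) = ((*v) c ^^ (p ^ r)) (t *v v)" for v
    proof -
      have "\<Phi> (t *v (c *v v)) = \<Phi> (((*v) c ^^ (p ^ r)) (t *v v))"
        unfolding tk \<Phi>_funpow \<Phi>_c by (simp add: mult_ac) (simp add: frob_def)
      thus ?thesis by (simp only: \<Phi>_inj)
    qed
    hence "t \<in> normalizer GL (generate GL {c})"
      using cS SC tC by (intro conjugate_power_normalizes) auto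
    thus False using * not_norm by blast
  qed
  have shear: "col_shear k v \<in> S" if vk: "v $ k = 0" for k and v :: "'a ^ 'n"
  proof (cases "n \<ge> 2")
    case False
    \<comment> \<open>In dimension one the only shear is the identity.\<close>
    have "n = 1" using n False by linarith
    hence "card (UNIV :: 'n set) = 1" by (simp add: n_def)
    hence "i = k" for i :: 'n by (metis UNIV_I card_1_singletonE singletonD)
    hence "v = 0" using vk by (simp add: vec_eq_iff) metis
    hence "col_shear k v = \<one>\<^bsub>GL\<^esub>" by (simp add: GL_def col_shear_def vec_eq_iff mat_def)
    thus ?thesis using subgroup.one_closed[OF S] by simp
  next
    case True
    obtain g where g: "g \<in> K" "\<And>v. to_ac (v $ k) = Tr (g * \<Phi> v)"
      using functional_is_trace_form[of "\<lambda>v. v $ k"] by auto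
    have "g \<noteq> 0"
    proof
      assume "g = 0"
      thus False using g(2)[of "axis k 1"] by (simp add: axis_def)
    qed
    have "g * \<Phi> v \<in> D0"
      using g(1) g(2)[of v] vk by (intro trace_zero_in_D0[OF aD a(2) True not_special]) auto
    hence "(\<lambda>x. x + (g * \<Phi> v) * Tr x) \<in> induced_maps S" by (simp add: D0_def D_def)
    from comp[OF scale[of "inverse g"] comp[OF this scale[OF g(1) \<open>g \<noteq> 0\<close>]]]
    have "(\<lambda>x. inverse g * (g * x + g * \<Phi> v * Tr (g * x))) \<in> induced_maps S"
      using g(1) \<open>g \<noteq> 0\<close> by auto
    then obtain A where A: "A \<in> S" "\<And>y. \<Phi> (A *v y) = inverse g * (g * \<Phi> y + g * \<Phi> v * Tr (g * \<Phi> y))"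
      by (auto simp: induced_maps_def)
    have "A *v y = col_shear k v *v y" for y
    proof -
      have "\<Phi> (A *v y) = \<Phi> y + \<Phi> v * Tr (g * \<Phi> y)"
        unfolding A(2) using \<open>g \<noteq> 0\<close> by (simp add: distrib_left mult.assoc[symmetric])
      also have "\<dots> = \<Phi> (col_shear k v *v y)"
        by (simp add: col_shear_apply \<Phi>_add \<Phi>_scale g(2) mult.commute)
      finally show ?thesis by (simp only: \<Phi>_inj)
    qed
    hence "A = col_shear k v" using matrix_eq by blast
    thus ?thesis using A(1) by simp
  qed
  have "A \<in> S" if "A \<in> carrier GL" for A
  proof (rule shears_and_determinants_generate[where S = S])
    show "A \<in> S \<Longrightarrow> B \<in> S \<Longrightarrow> A ** B \<in> S" for A B
      using subgroup.m_closed[OF S, of A B] by (simp add: GL_def)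
    show "\<exists>B\<in>S. B ** A = mat 1" if "A \<in> S" for A
      using GL.l_inv[of A] subgroup.m_inv_closed[OF S that] that SC
      by (intro bexI[of _ "inv\<^bsub>GL\<^esub> A"]) (auto simp: GL_def)
    show "\<exists>A\<in>S. det A = d" if d: "d \<noteq> 0" for d
    proof -
      obtain j where "det c ^ j = d" using det_power_surj[OF d] by blast
      moreover have "det (c [^]\<^bsub>GL\<^esub> j) = det c ^ j"
        by (induction j) (simp_all add: GL_def nat_pow_def det_mul det_I mult.commute)
      moreover have "c [^]\<^bsub>GL\<^esub> j \<in> S"
        using cS by (induction j) (auto intro: subgroup.m_closed[OF S] subgroup.one_closed[OF S])
      ultimately show ?thesis by blast
    qed
    show "invertible A" using that by (simp add: GL_def)
  qed (rule shear)
  thus ?thesis using SC by blast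
qed

end

theorem theorem7:
  fixes q n :: nat and c :: "'a::{field, finite} ^ 'n::finite ^ 'n"
  assumes "CARD('a) = q" and "CARD('n) = n" and "singer_cycle c"
  shows "(\<forall>t. reflection t \<longrightarrow> \<not> (n = 2 \<and> t \<in> normalizer GL (generate GL {c}))
             \<longrightarrow> generate GL {c, t} = carrier GL)
       \<and> (n \<ge> 3 \<longrightarrow> (\<forall>t. reflection t \<longrightarrow> generate GL {c, t} = carrier GL))"
proof -
  interpret GL: group "GL :: ('a ^ 'n ^ 'n) monoid" by (rule group_GL)
  obtain p r w \<Phi> where "singer_field_model p r CARD('n) w c \<Phi>"
    using singer_cycle_field_model[OF assms(3)] by blast
  then interpret singer_field_model p r "CARD('n)" w c \<Phi> .
  have "generate GL {c, t} = carrier GL"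
    if t: "reflection t" "\<not> (n = 2 \<and> t \<in> normalizer GL (generate GL {c}))" for t
  proof (rule subgroup_with_reflection_is_everything[OF _ _ _ t(1)])
    have "{c, t} \<subseteq> carrier GL" using assms(3) t(1) by (auto simp: singer_cycle_def reflection_def)
    thus "subgroup (generate GL {c, t}) GL" by (rule GL.generate_is_subgroup)
    show "c \<in> generate GL {c, t}" "t \<in> generate GL {c, t}" by (auto intro: generate.incl)
    show "\<not> (CARD('n) = 2 \<and> t \<in> normalizer GL (generate GL {c}))" using t(2) assms(2) by simp
  qed
  thus ?thesis by auto
qed

end
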